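(* Layered graphs form a width category $\Gamma=(\mathbf{Gr}_{\mathrm{Lyr}},\mathrm{Trees},\{K^{\mathbf{i}}\}_{\mathbf{i}\in\mathbf{I}})$. Furthermore, if $T$ is a tree and $d:\int T\to\mathbf{Gr}_{\mathrm{Lyr}}$ is a structured decomposition (of a layered graph $(G,L)$), then the width $w(d)$ of $d$ is precisely the width of the corresponding layered tree decomposition $(L,d)$ of $G$.
   Context: Graphs are finite and simple: a finite vertex set $V(G)$ with a symmetric irreflexive edge relation; homomorphisms are edge-preserving vertex maps; $\mathbf{Gr}$ is the resulting category. Finite sets are taken from a fixed small skeleton. A layering of a graph $G$ is a partition $(L_0,L_1,\dots)$ of $V(G)$ (empty parts allowed) such that if $xy$ is an edge with $x\in L_i$, $y\in L_j$, then $|i-j|\le1$. Equivalently, it is a morphism $L:G\to P^\infty_r$ of (possibly infinite) reflexive graphs, where $P^\infty_r$ has vertex set $\mathbb{N}$ and an edge $xy$ if and only if $|x-y|\le1$, and $G$ is regarded as a reflexive graph (so morphisms may collapse edges); that is, a function $L:V(G)\to\mathbb{N}$ with $|L(x)-L(y)|\le1$ for every edge $xy$, and $L_i=L^{-1}(i)$. $\mathbf{Gr}_{\mathrm{Lyr}}$ is the comma category $(i\downarrow P^\infty_r)$, with $i$ the inclusion of $\mathbf{Gr}$ into possibly infinite reflexive graphs: its objects are layered graphs $(G,L)$, and its morphisms are the graph homomorphisms commuting with the maps to $P^\infty_r$. $\mathbf{I}$ is the set of sequences $\mathbf{i}=(i_0,i_1,\dots)$ of non-negative integers with finitely many nonzero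 terms. $K^{\mathbf{i}}$ is the layered graph whose $n$th layer is a complete graph on $i_n$ vertices (empty if $i_n=0$) and in which every vertex of layer $n-1$ is adjacent to every vertex of layer $n$, for $n\ge1$ (no other edges). The spine $\{K^{\mathbf{i}}\}_{\mathbf{i}\in\mathbf{I}}$ is filtered by taking $\Omega_n$ to consist of the layered graphs $K^{\mathbf{i}}$ with $\max(\mathbf{i})\le n$ (up to isomorphism). A tree is a connected graph with no cycles; $\mathrm{Trees}$ is the set of all trees. For a graph $G$, the category $\int G$ has as objects the vertices and the (unordered) edges of $G$; its only non-identity morphisms are $e_x:e\to x$ and $e_y:e\to y$ for each edge $e=xy$. For a set $\mathcal{G}$ of graphs, a $\mathcal{G}$-structured decomposition in a category $\mathcal{C}$ is a functor $d:\int G\to\mathcal{C}$, $G\in\mathcal{G}$, sending every morphism to a monomorphism; the $d(v)$, $v\in V(G)$, are its bags, and the $d(e)$, $e$ an edge, its adhesions. It is a decomposition of an object $X$ if $X\cong\operatorname{colim} d$. Spined sd-category: a triple $(\mathcal{C},\mathcal{G},\Omega)$ with $\mathcal{C}$ a small category, $\mathcal{G}$ a set of graphs containing the one-vertex graph, such that (W1) every $\mathcal{G}$-structured decomposition has a colimit in $\mathcal{C}$; and $\Omega=\bigcup_{n\ge0}\Omega_n$ (the spine) a full subcategory closed under isomorphism, filtered by full subcategories $\Omega_0\subseteq\Omega_1\subseteq\cdots$ closed under isomorphism, such that (W2a) every object admits a monomorphism into some object of $\Omega$; (W2b) for $n\ge1$ and $W\in\Omega_n\setminus\Omega_{n-1}$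 there is no monomorphism from $W$ into an object of $\Omega_{n-1}$. Width category: a spined sd-category in which pullbacks of monomorphisms along arbitrary morphisms exist and (W3) for every $\mathcal{G}$-structured decomposition $d$ of an object $Y$ and every monomorphism $f:X\to Y$, the pullback along $f$ of the colimit cocone $(d(i)\to Y)_i$ (objects $X\times_Y d(i)$, with projections to $X$) exists and is a colimit cocone with apex $X$. Width: $s(X)$ is the smallest $n$ such that there is a monomorphism from $X$ into an object of $\Omega_n$; $w(d)=\max_{x\in V(G)}s(d(x))-1$ for $d:\int G\to\mathcal{C}$. Layered tree decomposition: a layered tree decomposition of a graph $G$ is a pair $(L,d)$ of a layering $L$ of $G$ and a tree decomposition $d$ of $G$ (a structured decomposition $\int T\to\mathbf{Gr}$ of $G$ with $T$ a tree; bags are regarded as subgraphs of $G$ via the colimit maps). Its width is the maximal number of vertices in the intersection of a bag of $d$ and a layer of $L$, i.e. $\max_{i,x}|L_i\cap V(d(x))|$. A structured decomposition $d:\int T\to\mathbf{Gr}_{\mathrm{Lyr}}$ of $(G,L)$ gives a layered tree decomposition of $G$ by forgetting the layerings of the bags and adhesions and pairing the resulting tree decomposition of $G$ with $L$.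
   Formalization: The width w(d) is shown to equal the width of the layered tree decomposition (L,d) minus 1; equality as stated fails for the given definitions (one-vertex tree with a one-vertex bag: w(d)=0, layered width 1). *)

theory Defs
  imports "HOL-Library.FuncSet"
begin

section \<open>Small categories\<close>

text \<open>Small categories with carriers, in the style of HOL-Algebra: objects and arrows form sets.
  \<open>Comp C g f\<close> is the composite of \<open>f\<close> followed by \<open>g\<close>; its value is only relevant when
  \<open>Cod C f = Dom C g\<close>.\<close>

record ('o, 'a) cat =
  Obj :: "'o set"
  Arr :: "'a set"
  Dom :: "'a \<Rightarrow> 'o"
  Cod :: "'a \<Rightarrow> 'o"
  Ident :: "'o \<Rightarrow> 'a"
  Comp :: "'a \<Rightarrow> 'a \<Rightarrow> 'a"

definition hom :: "('o, 'a) cat \<Rightarrow> 'o \<Rightarrow> 'o \<Rightarrow> 'a set" where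
  "hom C X Y = {f \<in> Arr C. Dom C f = X \<and> Cod C f = Y}"

locale category =
  fixes C :: "('o, 'a) cat"
  assumes dom_obj: "f \<in> Arr C \<Longrightarrow> Dom C f \<in> Obj C"
    and cod_obj: "f \<in> Arr C \<Longrightarrow> Cod C f \<in> Obj C"
    and ident_hom: "X \<in> Obj C \<Longrightarrow> Ident C X \<in> hom C X X"
    and comp_hom: "f \<in> hom C X Y \<Longrightarrow> g \<in> hom C Y Z \<Longrightarrow> Comp C g f \<in> hom C X Z"
    and comp_ident_right: "f \<in> hom C X Y \<Longrightarrow> Comp C f (Ident C X) = f"
    and comp_ident_left: "f \<in> hom C X Y \<Longrightarrow> Comp C (Ident C Y) f = f"
    and comp_assoc: "f \<in> hom C W X \<Longrightarrow> g \<in> hom C X Y \<Longrightarrow> h \<in> hom C Y Z \<Longrightarrow>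
      Comp C h (Comp C g f) = Comp C (Comp C h g) f"

definition isomorphic :: "('o, 'a) cat \<Rightarrow> 'o \<Rightarrow> 'o \<Rightarrow> bool" where
  "isomorphic C X Y \<longleftrightarrow> (\<exists>f\<in>hom C X Y. \<exists>g\<in>hom C Y X.
     Comp C g f = Ident C X \<and> Comp C f g = Ident C Y)"

definition monomorphism :: "('o, 'a) cat \<Rightarrow> 'a \<Rightarrow> bool" where
  "monomorphism C f \<longleftrightarrow> f \<in> Arr C \<and>
     (\<forall>Z. \<forall>g\<in>hom C Z (Dom C f). \<forall>h\<in>hom C Z (Dom C f). Comp C f g = Comp C f h \<longrightarrow> g = h)"

definition has_mono :: "('o, 'a) cat \<Rightarrow> 'o \<Rightarrow> 'o \<Rightarrow> bool" where
  "has_mono C X Y \<longleftrightarrow> (\<exists>f\<in>hom C X Y. monomorphism C f)"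

definition pullback ::
    "('o, 'a) cat \<Rightarrow> 'a \<Rightarrow> 'a \<Rightarrow> 'o \<Rightarrow> 'a \<Rightarrow> 'a \<Rightarrow> bool" where
  "pullback C f g P p q \<longleftrightarrow>
     f \<in> Arr C \<and> g \<in> Arr C \<and> Cod C f = Cod C g \<and>
     P \<in> Obj C \<and> p \<in> hom C P (Dom C f) \<and> q \<in> hom C P (Dom C g) \<and> Comp C f p = Comp C g q \<and>
     (\<forall>Q. \<forall>r\<in>hom C Q (Dom C f). \<forall>s\<in>hom C Q (Dom C g). Comp C f r = Comp C g s \<longrightarrow>
        (\<exists>!u. u \<in> hom C Q P \<and> Comp C p u = r \<and> Comp C q u = s))"

record ('j, 'k, 'o, 'a) diagram =
  fobj :: "'j \<Rightarrow> 'o"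
  farr :: "'k \<Rightarrow> 'a"

definition is_functor ::
    "('j, 'k) cat \<Rightarrow> ('o, 'a) cat \<Rightarrow> ('j, 'k, 'o, 'a) diagram \<Rightarrow> bool" where
  "is_functor J C F \<longleftrightarrow>
     (\<forall>i\<in>Obj J. fobj F i \<in> Obj C) \<and>
     (\<forall>a\<in>Arr J. farr F a \<in> hom C (fobj F (Dom J a)) (fobj F (Cod J a))) \<and>
     (\<forall>i\<in>Obj J. farr F (Ident J i) = Ident C (fobj F i)) \<and>
     (\<forall>a\<in>Arr J. \<forall>b\<in>Arr J. Cod J a = Dom J b \<longrightarrow>
        farr F (Comp J b a) = Comp C (farr F b) (farr F a))"

definition cocone :: "('j, 'k) cat \<Rightarrow> ('o, 'a) cat \<Rightarrow> ('j, 'k, 'o, 'a) diagram \<Rightarrow>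
    'o \<Rightarrow> ('j \<Rightarrow> 'a) \<Rightarrow> bool" where
  "cocone J C F X c \<longleftrightarrow>
     X \<in> Obj C \<and> (\<forall>i\<in>Obj J. c i \<in> hom C (fobj F i) X) \<and>
     (\<forall>a\<in>Arr J. Comp C (c (Cod J a)) (farr F a) = c (Dom J a))"

definition colimit_cocone :: "('j, 'k) cat \<Rightarrow> ('o, 'a) cat \<Rightarrow> ('j, 'k, 'o, 'a) diagram \<Rightarrow>
    'o \<Rightarrow> ('j \<Rightarrow> 'a) \<Rightarrow> bool" where
  "colimit_cocone J C F X c \<longleftrightarrow> cocone J C F X c \<and>
     (\<forall>Y e. cocone J C F Y e \<longrightarrow>
        (\<exists>!u. u \<in> hom C X Y \<and> (\<forall>i\<in>Obj J. Comp C u (c i) = e i)))"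

text \<open>\<open>pullback_cocone J C d c f d' p q\<close>: the cocone \<open>p\<close>, over the diagram \<open>d'\<close> and with apex
  \<open>Dom C f\<close>, is a pullback along \<open>f\<close> of the cocone \<open>c\<close> over \<open>d\<close>. So
  \<open>fobj d' i\<close> is \<open>X \<times>\<^sub>Y d(i)\<close> with projections \<open>p i\<close> to \<open>X\<close> and \<open>q i\<close> to \<open>d(i)\<close>, and the
  arrows of \<open>d'\<close> are the induced ones.\<close>
definition pullback_cocone :: "('j, 'k) cat \<Rightarrow> ('o, 'a) cat \<Rightarrow> ('j, 'k, 'o, 'a) diagram \<Rightarrow>
    ('j \<Rightarrow> 'a) \<Rightarrow> 'a \<Rightarrow> ('j, 'k, 'o, 'a) diagram \<Rightarrow> ('j \<Rightarrow> 'a) \<Rightarrow> ('j \<Rightarrow> 'a) \<Rightarrow> bool" where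
  "pullback_cocone J C d c f d' p q \<longleftrightarrow>
     is_functor J C d' \<and>
     (\<forall>i\<in>Obj J. pullback C f (c i) (fobj d' i) (p i) (q i)) \<and>
     (\<forall>a\<in>Arr J. Comp C (p (Cod J a)) (farr d' a) = p (Dom J a) \<and>
        Comp C (q (Cod J a)) (farr d' a) = Comp C (farr d a) (q (Dom J a)))"


section \<open>Graphs\<close>

record graph =
  verts :: "nat set"
  adj :: "(nat \<times> nat) set"

text \<open>The sets \<open>{..<n}\<close> are the chosen small skeleton of the finite sets.\<close>

definition is_graph :: "graph \<Rightarrow> bool" where
  "is_graph G \<longleftrightarrow> (\<exists>n. verts G = {..<n}) \<and> adj G \<subseteq> verts G \<times> verts G \<and> sym (adj G) \<and> irrefl (adj G)"

definition one_vertex_graph :: graph where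
  "one_vertex_graph = \<lparr>verts = {0}, adj = {}\<rparr>"

definition edge_set :: "graph \<Rightarrow> nat set set" where
  "edge_set G = {{x, y} | x y. (x, y) \<in> adj G}"

definition connected_graph :: "graph \<Rightarrow> bool" where
  "connected_graph G \<longleftrightarrow> verts G \<noteq> {} \<and> (\<forall>x\<in>verts G. \<forall>y\<in>verts G. (x, y) \<in> (adj G)\<^sup>*)"

definition is_cycle :: "graph \<Rightarrow> nat list \<Rightarrow> bool" where
  "is_cycle G xs \<longleftrightarrow> length xs \<ge> 3 \<and> distinct xs \<and>
     (\<forall>k<length xs. (xs ! k, xs ! (Suc k mod length xs)) \<in> adj G)"

definition Trees :: "graph set" where
  "Trees = {T. is_graph T \<and> connected_graph T \<and> (\<nexists>xs. is_cycle T xs)}"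


section \<open>Structured decompositions\<close>

text \<open>The category \<open>\<integral>G\<close>. The arrow \<open>Incl e x\<close> is \<open>e\<^sub>x : e \<rightarrow> x\<close>; of two composable arrows at least
  one is an identity.\<close>

datatype node = Vert nat | Edge "nat set"
datatype node_arr = IdArr node | Incl "nat set" nat

definition int_cat :: "graph \<Rightarrow> (node, node_arr) cat" where
  "int_cat G = \<lparr>
     Obj = Vert ` verts G \<union> Edge ` edge_set G,
     Arr = IdArr ` (Vert ` verts G \<union> Edge ` edge_set G) \<union> {Incl e x | e x. e \<in> edge_set G \<and> x \<in> e},
     Dom = (\<lambda>a. case a of IdArr i \<Rightarrow> i | Incl e x \<Rightarrow> Edge e),
     Cod = (\<lambda>a. case a of IdArr i \<Rightarrow> i | Incl e x \<Rightarrow> Vert x),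
     Ident = IdArr,
     Comp = (\<lambda>b a. case a of IdArr i \<Rightarrow> b | Incl e x \<Rightarrow> a)\<rparr>"

definition structured_decomposition ::
    "('o, 'a) cat \<Rightarrow> graph \<Rightarrow> (node, node_arr, 'o, 'a) diagram \<Rightarrow> bool" where
  "structured_decomposition C G d \<longleftrightarrow>
     is_functor (int_cat G) C d \<and> (\<forall>a\<in>Arr (int_cat G). monomorphism C (farr d a))"


section \<open>Width categories\<close>

text \<open>Full subcategories closed under isomorphism are given by their sets of objects; the spine is
  \<open>\<Union>n. \<Omega> n\<close>.\<close>

locale spined_sd_category = category C
  for C :: "('o, 'a) cat" +
  fixes \<G> :: "graph set" and \<Omega> :: "nat \<Rightarrow> 'o set"
  assumes shapes_graphs: "\<And>G. G \<in> \<G> \<Longrightarrow> is_graph G"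
    and one_vertex_shape: "one_vertex_graph \<in> \<G>"
    and W1: "\<And>G d. G \<in> \<G> \<Longrightarrow> structured_decomposition C G d \<Longrightarrow>
      \<exists>X c. colimit_cocone (int_cat G) C d X c"
    and spine_obj: "\<And>n. \<Omega> n \<subseteq> Obj C"
    and spine_iso: "\<And>n X Y. X \<in> \<Omega> n \<Longrightarrow> Y \<in> Obj C \<Longrightarrow> isomorphic C X Y \<Longrightarrow> Y \<in> \<Omega> n"
    and spine_mono: "\<And>n. \<Omega> n \<subseteq> \<Omega> (Suc n)"
    and W2a: "\<And>X. X \<in> Obj C \<Longrightarrow> \<exists>W \<in> (\<Union>n. \<Omega> n). has_mono C X W"
    and W2b: "\<And>n W W'. W \<in> \<Omega> (Suc n) - \<Omega> n \<Longrightarrow> W' \<in> \<Omega> n \<Longrightarrow> \<not> has_mono C W W'"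

locale width_category = spined_sd_category C \<G> \<Omega>
  for C :: "('o, 'a) cat" and \<G> :: "graph set" and \<Omega> :: "nat \<Rightarrow> 'o set" +
  assumes mono_pullbacks: "\<And>f g. monomorphism C f \<Longrightarrow> g \<in> Arr C \<Longrightarrow> Cod C f = Cod C g \<Longrightarrow>
      \<exists>P p q. pullback C f g P p q"
    and W3_ex: "\<And>G d Y c f. G \<in> \<G> \<Longrightarrow> structured_decomposition C G d \<Longrightarrow>
      colimit_cocone (int_cat G) C d Y c \<Longrightarrow> monomorphism C f \<Longrightarrow> Cod C f = Y \<Longrightarrow>
      \<exists>d' p q. pullback_cocone (int_cat G) C d c f d' p q"
    and W3: "\<And>G d Y c f d' p q. G \<in> \<G> \<Longrightarrow> structured_decomposition C G d \<Longrightarrow>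
      colimit_cocone (int_cat G) C d Y c \<Longrightarrow> monomorphism C f \<Longrightarrow> Cod C f = Y \<Longrightarrow>
      pullback_cocone (int_cat G) C d c f d' p q \<Longrightarrow>
      colimit_cocone (int_cat G) C d' (Dom C f) p"

definition spine_size :: "('o, 'a) cat \<Rightarrow> (nat \<Rightarrow> 'o set) \<Rightarrow> 'o \<Rightarrow> nat" where
  "spine_size C \<Omega> X = (LEAST n. \<exists>W\<in>\<Omega> n. has_mono C X W)"

definition decomposition_width :: "('o, 'a) cat \<Rightarrow> (nat \<Rightarrow> 'o set) \<Rightarrow> graph \<Rightarrow>
    (node, node_arr, 'o, 'a) diagram \<Rightarrow> int" where
  "decomposition_width C \<Omega> G d = int (Max ((\<lambda>x. spine_size C \<Omega> (fobj d (Vert x))) ` verts G)) - 1"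


section \<open>Graphs and layered graphs as categories\<close>

text \<open>An arrow is a triple (domain, map, codomain), where the map is extensional on the
  underlying set of the domain.\<close>

definition concrete_cat :: "'o set \<Rightarrow> ('o \<Rightarrow> nat set) \<Rightarrow> ('o \<Rightarrow> 'o \<Rightarrow> (nat \<Rightarrow> nat) \<Rightarrow> bool) \<Rightarrow>
    ('o, 'o \<times> (nat \<Rightarrow> nat) \<times> 'o) cat" where
  "concrete_cat Ob U H = \<lparr>
     Obj = Ob,
     Arr = {(A, f, B) | A f B. A \<in> Ob \<and> B \<in> Ob \<and> f \<in> U A \<rightarrow>\<^sub>E U B \<and> H A B f},
     Dom = (\<lambda>(A, f, B). A),
     Cod = (\<lambda>(A, f, B). B),
     Ident = (\<lambda>A. (A, \<lambda>x\<in>U A. x, A)),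
     Comp = (\<lambda>(B', g, C) (A, f, B). (A, compose (U A) g f, C))\<rparr>"

definition edge_preserving :: "graph \<Rightarrow> graph \<Rightarrow> (nat \<Rightarrow> nat) \<Rightarrow> bool" where
  "edge_preserving G H f \<longleftrightarrow> (\<forall>(x, y)\<in>adj G. (f x, f y) \<in> adj H)"

definition Gr :: "(graph, graph \<times> (nat \<Rightarrow> nat) \<times> graph) cat" where
  "Gr = concrete_cat {G. is_graph G} verts edge_preserving"

definition layering :: "graph \<Rightarrow> (nat \<Rightarrow> nat) \<Rightarrow> bool" where
  "layering G L \<longleftrightarrow> L \<in> extensional (verts G) \<and> (\<forall>(x, y)\<in>adj G. \<bar>int (L x) - int (L y)\<bar> \<le> 1)"

definition layer :: "graph \<Rightarrow> (nat \<Rightarrow> nat) \<Rightarrow> nat \<Rightarrow> nat set" where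
  "layer G L i = {x \<in> verts G. L x = i}"

type_synonym lgraph = "graph \<times> (nat \<Rightarrow> nat)"
type_synonym larrow = "lgraph \<times> (nat \<Rightarrow> nat) \<times> lgraph"

definition GrLyr :: "(lgraph, larrow) cat" where
  "GrLyr = concrete_cat {(G, L) | G L. is_graph G \<and> layering G L} (\<lambda>(G, L). verts G)
     (\<lambda>(G, L) (H, M) f. edge_preserving G H f \<and> (\<forall>x\<in>verts G. M (f x) = L x))"

definition seqI :: "(nat \<Rightarrow> nat) set" where
  "seqI = {i. finite {n. i n \<noteq> 0}}"

text \<open>The vertices of \<open>K\<^sup>i\<close> are numbered layer by layer, so layer \<open>n\<close> is
  \<open>{(\<Sum>k<n. i k) ..< (\<Sum>k\<le>n. i k)}\<close>.\<close>

definition K_layering :: "(nat \<Rightarrow> nat) \<Rightarrow> nat \<Rightarrow> nat" where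
  "K_layering i = (\<lambda>v\<in>{..<\<Sum>k\<in>{k. i k \<noteq> 0}. i k}. LEAST n. v < (\<Sum>k\<le>n. i k))"

definition K :: "(nat \<Rightarrow> nat) \<Rightarrow> lgraph" where
  "K i = (let V = {..<\<Sum>k\<in>{k. i k \<noteq> 0}. i k}; L = K_layering i in
     (\<lparr>verts = V, adj = {(x, y). x \<in> V \<and> y \<in> V \<and> x \<noteq> y \<and>
         (L x = L y \<or> L y = Suc (L x) \<or> L x = Suc (L y))}\<rparr>, L))"

definition spineK :: "nat \<Rightarrow> lgraph set" where
  "spineK n = {X \<in> Obj GrLyr. \<exists>i\<in>seqI. Max (range i) \<le> n \<and> isomorphic GrLyr X (K i)}"


section \<open>Layered tree decompositions\<close>

text \<open>The tree decomposition is given by the diagram \<open>d\<close> together with the colimit maps \<open>c\<close>,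
  through which the bags are regarded as subgraphs of \<open>G\<close>.\<close>

definition layered_tree_decomposition :: "graph \<Rightarrow> (nat \<Rightarrow> nat) \<Rightarrow> graph \<Rightarrow>
    (node, node_arr, graph, graph \<times> (nat \<Rightarrow> nat) \<times> graph) diagram \<Rightarrow>
    (node \<Rightarrow> graph \<times> (nat \<Rightarrow> nat) \<times> graph) \<Rightarrow> bool" where
  "layered_tree_decomposition G L T d c \<longleftrightarrow>
     is_graph G \<and> layering G L \<and> T \<in> Trees \<and> structured_decomposition Gr T d \<and>
     colimit_cocone (int_cat T) Gr d G c"

definition bag :: "(node, node_arr, graph, graph \<times> (nat \<Rightarrow> nat) \<times> graph) diagram \<Rightarrow>
    (node \<Rightarrow> graph \<times> (nat \<Rightarrow> nat) \<times> graph) \<Rightarrow> nat \<Rightarrow> nat set" where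
  "bag d c x = fst (snd (c (Vert x))) ` verts (fobj d (Vert x))"

text \<open>In contrast to \<open>decomposition_width\<close>, this width is not normalised by subtracting 1.\<close>

definition layered_width :: "graph \<Rightarrow> (nat \<Rightarrow> nat) \<Rightarrow> graph \<Rightarrow>
    (node, node_arr, graph, graph \<times> (nat \<Rightarrow> nat) \<times> graph) diagram \<Rightarrow>
    (node \<Rightarrow> graph \<times> (nat \<Rightarrow> nat) \<times> graph) \<Rightarrow> nat" where
  "layered_width G L T d c = Max {card (layer G L i \<inter> bag d c x) | i x. x \<in> verts T}"

definition forget_arr :: "larrow \<Rightarrow> graph \<times> (nat \<Rightarrow> nat) \<times> graph" where
  "forget_arr = (\<lambda>((G, L), f, (H, M)). (G, f, H))"

definition forget_diagram :: "(node, node_arr, lgraph, larrow) diagram \<Rightarrow>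
    (node, node_arr, graph, graph \<times> (nat \<Rightarrow> nat) \<times> graph) diagram" where
  "forget_diagram d = \<lparr>fobj = fst \<circ> fobj d, farr = forget_arr \<circ> farr d\<rparr>"

end

theory Submission
  imports Defs
begin

text \<open>The colimit of a tree-shaped diagram of injections is the quotient of the disjoint union of the
  bags that identifies the images of each element of an adhesion. In a tree every closed walk backtracks,
  so following identifications around a closed walk returns to the element one started from: the bags embed
  into the quotient. Hence no loops arise, the quotient is a layered graph, and it is also the colimit
  of the underlying graphs. Colimit cocones are thus exactly the cocones that are jointly surjective
  on vertices and on edges and identify only what the diagram identifies. Since elements and edges
  of a pullback are pairs of elements and edges, these three properties are stable under pullback,
  which is (W3). A layered graph embeds into \<open>K\<^sup>i\<close> iff its \<open>n\<close>th layer has at most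
  \<open>i n\<close> elements for all \<open>n\<close>, so the size of a layered graph is the size of its largest layer.\<close>

section \<open>Concrete categories\<close>

text \<open>A homomorphism of loopless graphs cannot collapse an edge, so \<open>GrLyr\<close> lacks
  some pushouts: the quotient of the bags is an object only if no identification reaches two
  adjacent vertices of one bag. This obstacle is why acyclicity of the shape enters, and the same
  fact is used again when bags are counted inside the colimit. (W1) asks for one colimit, but (W3)
  and the width formula speak of an arbitrary one, so the combinatorial description is proved for
  the explicit quotient and carried over along the comparison isomorphism. Likewise a pullback in
  (W3) is given only by its universal property; its vertices and edges are recovered by mapping
  one-vertex and one-edge layered graphs into it. Morphisms preserve layers, hence such a test
  object is needed for every layer and for every pair of layers that an edge can join. That
  identifications lift to the pullback is a unique-lifting argument over a fixed vertex of the
  subobject.\<close>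

definition fun_of :: "'o \<times> (nat \<Rightarrow> nat) \<times> 'o \<Rightarrow> nat \<Rightarrow> nat" where
  "fun_of a = fst (snd a)"

text \<open>\<open>Gr\<close> and \<open>GrLyr\<close> are both instances, so what is proved here
  about elements serves a layered decomposition as well as its image after the layers are
  forgotten.\<close>

locale concrete =
  fixes Ob :: "'o set" and U :: "'o \<Rightarrow> nat set" and H :: "'o \<Rightarrow> 'o \<Rightarrow> (nat \<Rightarrow> nat) \<Rightarrow> bool"
    and C :: "('o, 'o \<times> (nat \<Rightarrow> nat) \<times> 'o) cat"
  assumes C_eq: "C = concrete_cat Ob U H"
    and H_ident: "A \<in> Ob \<Longrightarrow> H A A (\<lambda>x\<in>U A. x)"
    and H_comp: "A \<in> Ob \<Longrightarrow> B \<in> Ob \<Longrightarrow> D \<in> Ob \<Longrightarrow> f \<in> U A \<rightarrow>\<^sub>E U B \<Longrightarrow> g \<in> U B \<rightarrow>\<^sub>E U D \<Longrightarrow>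
      H A B f \<Longrightarrow> H B D g \<Longrightarrow> H A D (compose (U A) g f)"
begin

lemma Obj_eq [simp]: "Obj C = Ob"
  by (simp add: C_eq concrete_cat_def)

lemma hom_iff: "a \<in> hom C A B \<longleftrightarrow>
    A \<in> Ob \<and> B \<in> Ob \<and> a = (A, fun_of a, B) \<and> fun_of a \<in> U A \<rightarrow>\<^sub>E U B \<and> H A B (fun_of a)"
  unfolding hom_def C_eq concrete_cat_def fun_of_def by (cases a) auto

lemma homI: "A \<in> Ob \<Longrightarrow> B \<in> Ob \<Longrightarrow> f \<in> U A \<rightarrow>\<^sub>E U B \<Longrightarrow> H A B f \<Longrightarrow> (A, f, B) \<in> hom C A B"
  unfolding hom_iff by (simp add: fun_of_def)

lemma Arr_hom: "a \<in> Arr C \<longleftrightarrow> a \<in> hom C (Dom C a) (Cod C a)"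
  by (simp add: hom_def)

lemma hom_Arr: "a \<in> hom C A B \<Longrightarrow> a \<in> Arr C \<and> Dom C a = A \<and> Cod C a = B"
  by (simp add: hom_def)

lemma hom_obj: "a \<in> hom C A B \<Longrightarrow> A \<in> Ob \<and> B \<in> Ob"
  by (simp add: hom_iff)

lemma fun_of_in: "a \<in> hom C A B \<Longrightarrow> x \<in> U A \<Longrightarrow> fun_of a x \<in> U B"
  unfolding hom_iff by auto

lemma hom_eqI:
  assumes "a \<in> hom C A B" "b \<in> hom C A B" "\<And>x. x \<in> U A \<Longrightarrow> fun_of a x = fun_of b x"
  shows "a = b"
proof -
  have "fun_of a = fun_of b"
    by (rule PiE_ext[of _ "U A" "\<lambda>_. U B"]) (use assms in \<open>auto simp: hom_iff\<close>)
  then show ?thesis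
    using assms(1,2) unfolding hom_iff by metis
qed

lemma Comp_eq:
  assumes "a \<in> hom C A B" "b \<in> hom C B D"
  shows "Comp C b a = (A, compose (U A) (fun_of b) (fun_of a), D)"
proof -
  obtain f g where "a = (A, f, B)" "b = (B, g, D)"
    using assms unfolding hom_iff by blast
  then show ?thesis
    by (simp add: C_eq concrete_cat_def fun_of_def)
qed

lemma fun_of_Comp:
  "a \<in> hom C A B \<Longrightarrow> b \<in> hom C B D \<Longrightarrow> x \<in> U A \<Longrightarrow> fun_of (Comp C b a) x = fun_of b (fun_of a x)"
  by (simp add: Comp_eq fun_of_def compose_def)

lemma fun_of_Ident: "x \<in> U A \<Longrightarrow> fun_of (Ident C A) x = x"
  by (simp add: C_eq concrete_cat_def fun_of_def)

lemma comp_in_hom: "a \<in> hom C A B \<Longrightarrow> b \<in> hom C B D \<Longrightarrow> Comp C b a \<in> hom C A D"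
  apply (simp only: Comp_eq)
  unfolding hom_iff[of a] hom_iff[of b]
  by (intro homI H_comp[of A B D]) (auto simp: compose_def PiE_iff)

lemma ident_in_hom: "A \<in> Ob \<Longrightarrow> Ident C A \<in> hom C A A"
  using homI[of A A "\<lambda>x\<in>U A. x"] H_ident[of A] by (simp add: C_eq concrete_cat_def)

lemma is_category: "category C"
proof
  fix f g h X Y Z W
  show "f \<in> Arr C \<Longrightarrow> Dom C f \<in> Obj C" "f \<in> Arr C \<Longrightarrow> Cod C f \<in> Obj C"
    by (auto simp: Arr_hom hom_iff)
  show "X \<in> Obj C \<Longrightarrow> Ident C X \<in> hom C X X"
    by (simp add: ident_in_hom)
  show "f \<in> hom C X Y \<Longrightarrow> g \<in> hom C Y Z \<Longrightarrow> Comp C g f \<in> hom C X Z"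
    by (rule comp_in_hom)
  show "Comp C f (Ident C X) = f" if f: "f \<in> hom C X Y"
  proof (rule hom_eqI[OF _ f])
    note i = ident_in_hom[OF hom_obj[OF f, THEN conjunct1]]
    show "Comp C f (Ident C X) \<in> hom C X Y"
      by (rule comp_in_hom[OF i f])
    show "fun_of (Comp C f (Ident C X)) x = fun_of f x" if "x \<in> U X" for x
      using fun_of_Comp[OF i f that] fun_of_Ident[OF that] by simp
  qed
  show "Comp C (Ident C Y) f = f" if f: "f \<in> hom C X Y"
  proof (rule hom_eqI[OF _ f])
    note i = ident_in_hom[OF hom_obj[OF f, THEN conjunct2]]
    show "Comp C (Ident C Y) f \<in> hom C X Y"
      by (rule comp_in_hom[OF f i])
    show "fun_of (Comp C (Ident C Y) f) x = fun_of f x" if "x \<in> U X" for x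
      using fun_of_Comp[OF f i that] fun_of_Ident[OF fun_of_in[OF f that]] by simp
  qed
  show "Comp C h (Comp C g f) = Comp C (Comp C h g) f"
    if f: "f \<in> hom C W X" and g: "g \<in> hom C X Y" and h: "h \<in> hom C Y Z"
  proof (rule hom_eqI)
    note gf = comp_in_hom[OF f g] and hg = comp_in_hom[OF g h]
    show "Comp C h (Comp C g f) \<in> hom C W Z" "Comp C (Comp C h g) f \<in> hom C W Z"
      by (rule comp_in_hom[OF gf h], rule comp_in_hom[OF f hg])
    show "fun_of (Comp C h (Comp C g f)) x = fun_of (Comp C (Comp C h g) f) x" if x: "x \<in> U W" for x
      using fun_of_Comp[OF gf h x] fun_of_Comp[OF f hg x] fun_of_Comp[OF f g x]
        fun_of_Comp[OF g h fun_of_in[OF f x]] by simp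
  qed
qed

lemma monoI:
  assumes "f \<in> hom C A B" "inj_on (fun_of f) (U A)"
  shows "monomorphism C f"
  unfolding monomorphism_def
proof (intro conjI allI ballI impI)
  show "f \<in> Arr C"
    using assms hom_Arr by blast
  fix Z g h
  assume g: "g \<in> hom C Z (Dom C f)" and h: "h \<in> hom C Z (Dom C f)" and eq: "Comp C f g = Comp C f h"
  have D: "Dom C f = A"
    using assms hom_Arr by blast
  show "g = h"
  proof (rule hom_eqI[OF g h])
    fix x assume x: "x \<in> U Z"
    have "fun_of f (fun_of g x) = fun_of f (fun_of h x)"
      using fun_of_Comp[OF g[unfolded D] assms(1) x] fun_of_Comp[OF h[unfolded D] assms(1) x] eq by simp
    then show "fun_of g x = fun_of h x"
      using assms(2) g h x D fun_of_in by (metis inj_onD)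
  qed
qed

end

section \<open>Identification of elements along a diagram\<close>

definition elem_step :: "('j, 'k) cat \<Rightarrow> ('o \<Rightarrow> nat set) \<Rightarrow> ('j, 'k, 'o, 'o \<times> (nat \<Rightarrow> nat) \<times> 'o) diagram \<Rightarrow>
    (('j \<times> nat) \<times> ('j \<times> nat)) set" where
  "elem_step J U F = {((Dom J a, x), (Cod J a, fun_of (farr F a) x)) | a x.
     a \<in> Arr J \<and> x \<in> U (fobj F (Dom J a))}"

text \<open>The pairs in \<open>elem_step\<close> are the arrows of the category of elements of the
  underlying-set functor, and \<open>elem_eq\<close> says that two elements lie in the same
  connected component. The colimit of the underlying sets is the set of these components.\<close>

definition elem_eq where
  "elem_eq J U F = (elem_step J U F \<union> (elem_step J U F)\<inverse>)\<^sup>*"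

text \<open>Only one inclusion between the kernel of the cocone and \<open>elem_eq\<close> is
  demanded, because the other holds for every cocone by \<open>cocone_elem_eq\<close>.\<close>

definition set_colimit :: "('j, 'k) cat \<Rightarrow> ('o \<Rightarrow> nat set) \<Rightarrow> ('j, 'k, 'o, 'o \<times> (nat \<Rightarrow> nat) \<times> 'o) diagram \<Rightarrow>
    'o \<Rightarrow> ('j \<Rightarrow> 'o \<times> (nat \<Rightarrow> nat) \<times> 'o) \<Rightarrow> bool" where
  "set_colimit J U F X c \<longleftrightarrow>
     (\<forall>x\<in>U X. \<exists>i\<in>Obj J. \<exists>a\<in>U (fobj F i). fun_of (c i) a = x) \<and>
     (\<forall>i\<in>Obj J. \<forall>j\<in>Obj J. \<forall>a\<in>U (fobj F i). \<forall>b\<in>U (fobj F j).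
        fun_of (c i) a = fun_of (c j) b \<longrightarrow> ((i, a), (j, b)) \<in> elem_eq J U F)"

lemma elem_eq_equiv: "equiv UNIV (elem_eq J U F)"
  unfolding elem_eq_def
  by (rule equivI) (auto intro: refl_rtrancl trans_rtrancl sym_rtrancl sym_Un_converse simp: refl_on_def)

lemma elem_eq_refl: "(p, p) \<in> elem_eq J U F"
  and elem_eq_sym: "(p, q) \<in> elem_eq J U F \<Longrightarrow> (q, p) \<in> elem_eq J U F"
  and elem_eq_trans: "(p, q) \<in> elem_eq J U F \<Longrightarrow> (q, r) \<in> elem_eq J U F \<Longrightarrow> (p, r) \<in> elem_eq J U F"
  using elem_eq_equiv[of J U F] by (meson UNIV_I equivE refl_onD symD transD)+

lemma elem_eq_step: "a \<in> Arr J \<Longrightarrow> x \<in> U (fobj F (Dom J a)) \<Longrightarrow>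
    ((Dom J a, x), (Cod J a, fun_of (farr F a) x)) \<in> elem_eq J U F"
  unfolding elem_eq_def elem_step_def by blast

text \<open>Induction along a zigzag: the invariant has to survive an arrow traversed in either
  direction.\<close>

lemma elem_eq_induct [consumes 1, case_names refl fwd bwd]:
  assumes "((i, a), (j, b)) \<in> elem_eq J U F"
    and "P i a"
    and "\<And>k x. k \<in> Arr J \<Longrightarrow> x \<in> U (fobj F (Dom J k)) \<Longrightarrow> P (Dom J k) x \<Longrightarrow> P (Cod J k) (fun_of (farr F k) x)"
    and "\<And>k x. k \<in> Arr J \<Longrightarrow> x \<in> U (fobj F (Dom J k)) \<Longrightarrow> P (Cod J k) (fun_of (farr F k) x) \<Longrightarrow> P (Dom J k) x"
  shows "P j b"
proof -
  have "P (fst q) (snd q)" if "((i, a), q) \<in> elem_eq J U F" for q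
    using that unfolding elem_eq_def
  proof (induction rule: rtrancl_induct)
    case base
    then show ?case using assms(2) by simp
  next
    case (step p q)
    then show ?case
      using assms(3,4) by (auto simp: elem_step_def)
  qed
  from this[OF assms(1)] show ?thesis by simp
qed

section \<open>Colimits computed on underlying sets\<close>

context concrete
begin

lemma farr_hom:
  "is_functor J C F \<Longrightarrow> k \<in> Arr J \<Longrightarrow> farr F k \<in> hom C (fobj F (Dom J k)) (fobj F (Cod J k))"
  by (simp add: is_functor_def)

lemma cocone_hom: "cocone J C F X c \<Longrightarrow> i \<in> Obj J \<Longrightarrow> c i \<in> hom C (fobj F i) X"
  by (simp add: cocone_def)

lemma cocone_farr:
  assumes F: "is_functor J C F" and J: "category J" and c: "cocone J C F X c"
    and k: "k \<in> Arr J" and x: "x \<in> U (fobj F (Dom J k))"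
  shows "fun_of (c (Cod J k)) (fun_of (farr F k) x) = fun_of (c (Dom J k)) x"
proof -
  have "Comp C (c (Cod J k)) (farr F k) = c (Dom J k)"
    using c k by (simp add: cocone_def)
  moreover have "c (Cod J k) \<in> hom C (fobj F (Cod J k)) X"
    using cocone_hom[OF c category.cod_obj[OF J k]] .
  ultimately show ?thesis
    using fun_of_Comp[OF farr_hom[OF F k] _ x] by metis
qed

lemma cocone_elem_eq:
  assumes F: "is_functor J C F" and J: "category J" and c: "cocone J C F X c"
    and eq: "((i, a), (j, b)) \<in> elem_eq J U F"
  shows "fun_of (c j) b = fun_of (c i) a"
  using eq
  by (induction rule: elem_eq_induct) (simp_all add: cocone_farr[OF F J c])

text \<open>The assumption \<open>final\<close> says that \<open>X\<close> carries the final
  structure: a function out of \<open>X\<close> is a morphism once its composites with the cocone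
  maps are. Then the function induced on underlying sets is the mediating arrow.\<close>

lemma set_colimit_imp_colimit:
  assumes F: "is_functor J C F" and J: "category J" and c: "cocone J C F X c"
    and col: "set_colimit J U F X c"
    and final: "\<And>Y u. Y \<in> Ob \<Longrightarrow> u \<in> U X \<rightarrow>\<^sub>E U Y \<Longrightarrow>
      (\<And>i. i \<in> Obj J \<Longrightarrow> H (fobj F i) Y (compose (U (fobj F i)) u (fun_of (c i)))) \<Longrightarrow> H X Y u"
  shows "colimit_cocone J C F X c"
  unfolding colimit_cocone_def
proof (intro conjI allI impI c)
  fix Y e
  assume e: "cocone J C F Y e"
  have Y: "Y \<in> Ob" and X: "X \<in> Ob"
    using e c by (auto simp: cocone_def)
  \<comment> \<open>\<open>R\<close> is the graph of the mediating map. It is single-valued because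
    two preimages of \<open>x\<close> are related by \<open>elem_eq\<close>, on which
    \<open>e\<close> is constant, so the choice in \<open>u\<close> is immaterial.\<close>
  define R where "R x y \<longleftrightarrow> (\<exists>i\<in>Obj J. \<exists>a\<in>U (fobj F i). fun_of (c i) a = x \<and> fun_of (e i) a = y)" for x y
  define u where "u = (\<lambda>x\<in>U X. SOME y. R x y)"
  have surj: "\<exists>i\<in>Obj J. \<exists>a\<in>U (fobj F i). fun_of (c i) a = x" if "x \<in> U X" for x
    using col that unfolding set_colimit_def by blast
  have u: "u (fun_of (c i) a) = fun_of (e i) a" if i: "i \<in> Obj J" and a: "a \<in> U (fobj F i)" for i a
  proof -
    have "R (fun_of (c i) a) (fun_of (e i) a)"
      using i a unfolding R_def by blast
    then have "R (fun_of (c i) a) (SOME y. R (fun_of (c i) a) y)"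
      by (rule someI)
    then obtain j b where j: "j \<in> Obj J" "b \<in> U (fobj F j)"
      and cj: "fun_of (c j) b = fun_of (c i) a"
      and ej: "fun_of (e j) b = (SOME y. R (fun_of (c i) a) y)"
      unfolding R_def by blast
    have "((j, b), (i, a)) \<in> elem_eq J U F"
      using col cj i a j unfolding set_colimit_def by blast
    then have "fun_of (e i) a = fun_of (e j) b"
      by (rule cocone_elem_eq[OF F J e])
    moreover have "fun_of (c i) a \<in> U X"
      using fun_of_in[OF cocone_hom[OF c i] a] .
    ultimately show ?thesis
      using ej by (simp add: u_def)
  qed
  have uY: "u \<in> U X \<rightarrow>\<^sub>E U Y"
  proof (rule PiE_I)
    show "u x \<in> U Y" if "x \<in> U X" for x
      using surj[OF that] u fun_of_in[OF cocone_hom[OF e]] by metis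
  qed (simp add: u_def)
  have "H X Y u"
  proof (rule final[OF Y uY])
    fix i assume i: "i \<in> Obj J"
    have "compose (U (fobj F i)) u (fun_of (c i)) = fun_of (e i)"
    proof
      show "compose (U (fobj F i)) u (fun_of (c i)) a = fun_of (e i) a" for a
        using u[OF i] cocone_hom[OF e i, unfolded hom_iff]
        by (cases "a \<in> U (fobj F i)") (auto simp: compose_def)
    qed
    then show "H (fobj F i) Y (compose (U (fobj F i)) u (fun_of (c i)))"
      using cocone_hom[OF e i, unfolded hom_iff] by simp
  qed
  then have hom: "(X, u, Y) \<in> hom C X Y"
    by (rule homI[OF X Y uY])
  have fu: "fun_of (X, u, Y) = u"
    by (simp add: fun_of_def)
  show "\<exists>!u. u \<in> hom C X Y \<and> (\<forall>i\<in>Obj J. Comp C u (c i) = e i)"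
  proof (rule ex1I[of _ "(X, u, Y)"])
    show "(X, u, Y) \<in> hom C X Y \<and> (\<forall>i\<in>Obj J. Comp C (X, u, Y) (c i) = e i)"
    proof (intro conjI ballI hom)
      fix i assume i: "i \<in> Obj J"
      show "Comp C (X, u, Y) (c i) = e i"
        by (rule hom_eqI[OF comp_in_hom[OF cocone_hom[OF c i] hom] cocone_hom[OF e i]])
          (simp add: fun_of_Comp[OF cocone_hom[OF c i] hom] fu u i)
    qed
  next
    fix v assume v: "v \<in> hom C X Y \<and> (\<forall>i\<in>Obj J. Comp C v (c i) = e i)"
    show "v = (X, u, Y)"
    proof (rule hom_eqI[OF conjunct1[OF v] hom])
      fix x assume "x \<in> U X"
      then obtain i a where ia: "i \<in> Obj J" "a \<in> U (fobj F i)" "fun_of (c i) a = x"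
        using surj by blast
      have "fun_of v x = fun_of (Comp C v (c i)) a"
        using fun_of_Comp[OF cocone_hom[OF c ia(1)] conjunct1[OF v] ia(2)] ia(3) by simp
      also have "\<dots> = u x"
        using v u ia by metis
      finally show "fun_of v x = fun_of (X, u, Y) x"
        by (simp add: fu)
    qed
  qed
qed

text \<open>The comparison isomorphism is given elementwise, since the properties to be transported
  along it, surjectivity and the kernel of the cocone, are about elements.\<close>

lemma colimit_iso:
  assumes X: "colimit_cocone J C F X c" and Y: "colimit_cocone J C F Y e"
  shows "\<exists>u\<in>hom C X Y. \<exists>v\<in>hom C Y X. (\<forall>x\<in>U X. fun_of v (fun_of u x) = x) \<and>
    (\<forall>i\<in>Obj J. \<forall>a\<in>U (fobj F i). fun_of u (fun_of (c i) a) = fun_of (e i) a \<and>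
      fun_of v (fun_of (e i) a) = fun_of (c i) a)"
proof -
  interpret category C by (rule is_category)
  have cX: "cocone J C F X c" and cY: "cocone J C F Y e"
    using X Y by (auto simp: colimit_cocone_def)
  obtain u where u: "u \<in> hom C X Y" "\<forall>i\<in>Obj J. Comp C u (c i) = e i"
    using X cY unfolding colimit_cocone_def by blast
  obtain v where v: "v \<in> hom C Y X" "\<forall>i\<in>Obj J. Comp C v (e i) = c i"
    using Y cX unfolding colimit_cocone_def by blast
  have obX: "X \<in> Ob"
    using cX by (simp add: cocone_def)
  have "Comp C v u = Ident C X"
  proof -
    have "\<exists>!w. w \<in> hom C X X \<and> (\<forall>i\<in>Obj J. Comp C w (c i) = c i)"
      using X cX unfolding colimit_cocone_def by blast
    moreover have "Comp C v u \<in> hom C X X \<and> (\<forall>i\<in>Obj J. Comp C (Comp C v u) (c i) = c i)"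
      using comp_hom[OF u(1) v(1)] comp_assoc[OF cocone_hom[OF cX] u(1) v(1)] u(2) v(2) by simp
    moreover have "Ident C X \<in> hom C X X \<and> (\<forall>i\<in>Obj J. Comp C (Ident C X) (c i) = c i)"
      using ident_in_hom[OF obX] comp_ident_left[OF cocone_hom[OF cX]] by simp
    ultimately show ?thesis by blast
  qed
  then have "fun_of v (fun_of u x) = x" if "x \<in> U X" for x
    using fun_of_Comp[OF u(1) v(1) that] fun_of_Ident[OF that] by simp
  moreover have "fun_of u (fun_of (c i) a) = fun_of (e i) a" "fun_of v (fun_of (e i) a) = fun_of (c i) a"
    if "i \<in> Obj J" "a \<in> U (fobj F i)" for i a
    using fun_of_Comp[OF cocone_hom[OF cX that(1)] u(1) that(2)]
      fun_of_Comp[OF cocone_hom[OF cY that(1)] v(1) that(2)] u(2) v(2) that(1) by auto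
  ultimately show ?thesis
    using u(1) v(1) by blast
qed

lemma set_colimit_transfer:
  assumes X: "colimit_cocone J C F X c" and Y: "colimit_cocone J C F Y e"
    and sX: "set_colimit J U F X c"
  shows "set_colimit J U F Y e"
proof -
  obtain u v where uv: "u \<in> hom C Y X" "v \<in> hom C X Y"
    "\<forall>y\<in>U Y. fun_of v (fun_of u y) = y"
    "\<forall>i\<in>Obj J. \<forall>a\<in>U (fobj F i). fun_of u (fun_of (e i) a) = fun_of (c i) a \<and>
      fun_of v (fun_of (c i) a) = fun_of (e i) a"
    using colimit_iso[OF Y X] by blast
  show ?thesis
    unfolding set_colimit_def
  proof (intro conjI ballI impI)
    fix y assume y: "y \<in> U Y"
    then obtain i a where ia: "i \<in> Obj J" "a \<in> U (fobj F i)" "fun_of (c i) a = fun_of u y"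
      using sX fun_of_in[OF uv(1)] unfolding set_colimit_def by blast
    then have "fun_of (e i) a = y"
      using uv(3,4) y by metis
    then show "\<exists>i\<in>Obj J. \<exists>a\<in>U (fobj F i). fun_of (e i) a = y"
      using ia by blast
  next
    fix i j a b
    assume "i \<in> Obj J" "j \<in> Obj J" "a \<in> U (fobj F i)" "b \<in> U (fobj F j)" "fun_of (e i) a = fun_of (e j) b"
    then show "((i, a), (j, b)) \<in> elem_eq J U F"
      using sX uv(4) unfolding set_colimit_def by metis
  qed
qed

end

text \<open>Objectwise pullbacks assemble into a functor: each arrow of the new diagram is the one
  induced into the pullback at its codomain, and the functor laws hold because the two projections
  of a pullback are jointly monic.\<close>

lemma (in category) pullback_cocone_ex:
  assumes J: "category J" and F: "is_functor J C d" and c: "cocone J C d Y c"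
    and f: "f \<in> hom C X Y"
    and pb: "\<And>i. i \<in> Obj J \<Longrightarrow> \<exists>P p q. pullback C f (c i) P p q"
  shows "\<exists>d' p q. pullback_cocone J C d c f d' p q"
proof -
  have "\<exists>z. i \<in> Obj J \<longrightarrow> pullback C f (c i) (fst z) (fst (snd z)) (snd (snd z))" for i
    using pb[of i] by fastforce
  then obtain z where z: "\<And>i. i \<in> Obj J \<Longrightarrow> pullback C f (c i) (fst (z i)) (fst (snd (z i))) (snd (snd (z i)))"
    by metis
  define P where "P i = fst (z i)" for i
  define p where "p i = fst (snd (z i))" for i
  define q where "q i = snd (snd (z i))" for i
  have dom: "Dom C f = X"
    using f by (simp add: hom_def)
  have ch: "c i \<in> hom C (fobj d i) Y" and domc: "Dom C (c i) = fobj d i" if "i \<in> Obj J" for i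
    using c that by (auto simp: cocone_def hom_def)
  have pq: "pullback C f (c i) (P i) (p i) (q i)" if "i \<in> Obj J" for i
    using z[OF that] by (simp add: P_def p_def q_def)
  have P: "P i \<in> Obj C" and p: "p i \<in> hom C (P i) X" and q: "q i \<in> hom C (P i) (fobj d i)"
    and comm: "Comp C f (p i) = Comp C (c i) (q i)" if "i \<in> Obj J" for i
    using pq[OF that] dom domc[OF that] by (auto simp: pullback_def)
  have univ: "\<exists>!u. u \<in> hom C Q (P i) \<and> Comp C (p i) u = r \<and> Comp C (q i) u = s"
    if "i \<in> Obj J" "r \<in> hom C Q X" "s \<in> hom C Q (fobj d i)" "Comp C f r = Comp C (c i) s" for i Q r s
    using pq[OF that(1)] that dom domc[OF that(1)] unfolding pullback_def by metis
  have fh: "farr d k \<in> hom C (fobj d (Dom J k)) (fobj d (Cod J k))"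
    and ck: "Comp C (c (Cod J k)) (farr d k) = c (Dom J k)"
    and DJ: "Dom J k \<in> Obj J" and CJ: "Cod J k \<in> Obj J" if "k \<in> Arr J" for k
    using F c that category.dom_obj[OF J that] category.cod_obj[OF J that]
    by (auto simp: is_functor_def cocone_def)
  have ex: "\<exists>!u. u \<in> hom C (P (Dom J k)) (P (Cod J k)) \<and> Comp C (p (Cod J k)) u = p (Dom J k) \<and>
      Comp C (q (Cod J k)) u = Comp C (farr d k) (q (Dom J k))" if k: "k \<in> Arr J" for k
  proof (rule univ[OF CJ[OF k] p[OF DJ[OF k]]])
    show "Comp C (farr d k) (q (Dom J k)) \<in> hom C (P (Dom J k)) (fobj d (Cod J k))"
      by (rule comp_hom[OF q[OF DJ[OF k]] fh[OF k]])
    show "Comp C f (p (Dom J k)) = Comp C (c (Cod J k)) (Comp C (farr d k) (q (Dom J k)))"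
      using comp_assoc[OF q[OF DJ[OF k]] fh[OF k] ch[OF CJ[OF k]]] ck[OF k] comm[OF DJ[OF k]] by simp
  qed
  define m where "m k = (THE u. u \<in> hom C (P (Dom J k)) (P (Cod J k)) \<and> Comp C (p (Cod J k)) u = p (Dom J k) \<and>
      Comp C (q (Cod J k)) u = Comp C (farr d k) (q (Dom J k)))" for k
  have m: "m k \<in> hom C (P (Dom J k)) (P (Cod J k))" "Comp C (p (Cod J k)) (m k) = p (Dom J k)"
    "Comp C (q (Cod J k)) (m k) = Comp C (farr d k) (q (Dom J k))" if "k \<in> Arr J" for k
    using theI'[OF ex[OF that]] unfolding m_def by blast+
  have jm: "u = v" if "i \<in> Obj J" "u \<in> hom C Q (P i)" "v \<in> hom C Q (P i)"
    "Comp C (p i) u = Comp C (p i) v" "Comp C (q i) u = Comp C (q i) v" for i Q u v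
  proof -
    have "Comp C f (Comp C (p i) v) = Comp C (c i) (Comp C (q i) v)"
      using comp_assoc[OF that(3) p f] comp_assoc[OF that(3) q ch] comm that(1) by simp
    from univ[OF that(1) comp_hom[OF that(3) p[OF that(1)]] comp_hom[OF that(3) q[OF that(1)]] this]
    show ?thesis using that by blast
  qed
  let ?d = "\<lparr>fobj = P, farr = m\<rparr>"
  have "is_functor J C ?d"
    unfolding is_functor_def
  proof (intro conjI ballI impI)
    fix i assume i: "i \<in> Obj J"
    show "fobj ?d i \<in> Obj C"
      using P[OF i] by simp
    have I: "Ident J i \<in> Arr J" "Dom J (Ident J i) = i" "Cod J (Ident J i) = i"
      using category.ident_hom[OF J i] by (auto simp: hom_def)
    have "m (Ident J i) = Ident C (P i)"
    proof (rule jm[OF i])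
      show "m (Ident J i) \<in> hom C (P i) (P i)"
        using m(1)[OF I(1)] I by simp
      show "Ident C (P i) \<in> hom C (P i) (P i)"
        by (rule ident_hom[OF P[OF i]])
      show "Comp C (p i) (m (Ident J i)) = Comp C (p i) (Ident C (P i))"
        using m(2)[OF I(1)] I comp_ident_right[OF p[OF i]] by simp
      have "farr d (Ident J i) = Ident C (fobj d i)"
        using F i by (simp add: is_functor_def)
      then show "Comp C (q i) (m (Ident J i)) = Comp C (q i) (Ident C (P i))"
        using m(3)[OF I(1)] I comp_ident_right[OF q[OF i]] comp_ident_left[OF q[OF i]] by simp
    qed
    then show "farr ?d (Ident J i) = Ident C (fobj ?d i)"
      by simp
  next
    fix k assume "k \<in> Arr J"
    then show "farr ?d k \<in> hom C (fobj ?d (Dom J k)) (fobj ?d (Cod J k))"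
      using m(1) by simp
  next
    fix a b assume a: "a \<in> Arr J" and b: "b \<in> Arr J" and ab: "Cod J a = Dom J b"
    have "Comp J b a \<in> hom J (Dom J a) (Cod J b)"
      by (rule category.comp_hom[OF J, of _ _ "Cod J a"]) (simp_all add: hom_def a b ab)
    then have ba: "Comp J b a \<in> Arr J" "Dom J (Comp J b a) = Dom J a" "Cod J (Comp J b a) = Cod J b"
      by (auto simp: hom_def)
    note ma = m(1)[OF a, unfolded ab] and mb = m(1)[OF b]
    note qa = q[OF DJ[OF a]] and fa = fh[OF a, unfolded ab]
    have "m (Comp J b a) = Comp C (m b) (m a)"
    proof (rule jm[OF CJ[OF b]])
      show "m (Comp J b a) \<in> hom C (P (Dom J a)) (P (Cod J b))"
        using m(1)[OF ba(1)] ba by simp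
      show "Comp C (m b) (m a) \<in> hom C (P (Dom J a)) (P (Cod J b))"
        by (rule comp_hom[OF ma mb])
      show "Comp C (p (Cod J b)) (m (Comp J b a)) = Comp C (p (Cod J b)) (Comp C (m b) (m a))"
        using m(2)[OF ba(1)] ba m(2)[OF a] m(2)[OF b] ab comp_assoc[OF ma mb p[OF CJ[OF b]]] by simp
      have "farr d (Comp J b a) = Comp C (farr d b) (farr d a)"
        using F a b ab by (simp add: is_functor_def)
      then show "Comp C (q (Cod J b)) (m (Comp J b a)) = Comp C (q (Cod J b)) (Comp C (m b) (m a))"
        using m(3)[OF ba(1)] ba m(3)[OF a] m(3)[OF b] ab comp_assoc[OF ma mb q[OF CJ[OF b]]]
          comp_assoc[OF ma q[OF DJ[OF b]] fh[OF b]] comp_assoc[OF qa fa fh[OF b]] by simp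
    qed
    then show "farr ?d (Comp J b a) = Comp C (farr ?d b) (farr ?d a)"
      by simp
  qed
  then have "pullback_cocone J C d c f ?d p q"
    unfolding pullback_cocone_def using pq m by simp
  then show ?thesis by blast
qed

section \<open>Walks in trees\<close>

lemma edge_setE:
  assumes "is_graph T" "e \<in> edge_set T"
  obtains x y where "e = {x, y}" "x \<noteq> y" "(x, y) \<in> adj T" "x \<in> verts T" "y \<in> verts T"
  using assms unfolding edge_set_def is_graph_def irrefl_def by blast

lemma edge_set_adj:
  assumes "is_graph T" "e \<in> edge_set T" "x \<in> e" "y \<in> e" "x \<noteq> y"
  shows "(x, y) \<in> adj T" "e = {x, y}"
proof -
  obtain u v where uv: "e = {u, v}" "(u, v) \<in> adj T"
    using assms(1,2) by (rule edge_setE)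
  moreover have "(v, u) \<in> adj T"
    using uv assms(1) by (auto simp: is_graph_def dest: symD)
  ultimately show "(x, y) \<in> adj T" "e = {x, y}"
    using assms(3-5) by auto
qed

lemma finite_verts: "is_graph G \<Longrightarrow> finite (verts G)"
  by (auto simp: is_graph_def)

section \<open>The index category of a tree-shaped diagram\<close>

lemma Obj_int_cat: "Obj (int_cat G) = Vert ` verts G \<union> Edge ` edge_set G"
  and Dom_int_cat [simp]: "Dom (int_cat G) (Incl e x) = Edge e" "Dom (int_cat G) (IdArr i) = i"
  and Cod_int_cat [simp]: "Cod (int_cat G) (Incl e x) = Vert x" "Cod (int_cat G) (IdArr i) = i"
  and Arr_int_cat: "Arr (int_cat G) = IdArr ` Obj (int_cat G) \<union> {Incl e x | e x. e \<in> edge_set G \<and> x \<in> e}"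
  and Ident_int_cat: "Ident (int_cat G) = IdArr"
  by (simp_all add: int_cat_def)

lemma finite_Obj_int_cat:
  assumes "is_graph G"
  shows "finite (Obj (int_cat G))"
proof -
  have "edge_set G \<subseteq> Pow (verts G)"
    using assms by (auto elim!: edge_setE)
  then show ?thesis
    using finite_verts[OF assms] by (auto simp: Obj_int_cat intro: finite_subset)
qed

lemma int_cat_category:
  assumes G: "is_graph G"
  shows "category (int_cat G)"
proof -
  have "x \<in> verts G" if "e \<in> edge_set G" "x \<in> e" for e x
    using G that by (auto elim!: edge_setE)
  then show ?thesis
    by unfold_locales (auto simp: int_cat_def hom_def split: node_arr.splits)
qed

text \<open>Take the shortest stretch \<open>d\<close> of the walk that returns to its starting
  vertex. Length 1 would be a loop; length at least 3 would be a cycle, because minimality makes its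
  vertices distinct; so the length is 2.\<close>

lemma closed_walk_backtrack:
  assumes T: "is_graph T" and acyc: "\<nexists>xs. is_cycle T xs"
    and n: "n > 0" and walk: "\<And>k. k < n \<Longrightarrow> (w k, w (Suc k)) \<in> adj T" and closed: "w n = w 0"
  shows "\<exists>k. k + 2 \<le> n \<and> w (k + 2) = w k"
proof -
  define R where "R d \<longleftrightarrow> d > 0 \<and> (\<exists>i. i + d \<le> n \<and> w (i + d) = w i)" for d
  define d where "d = (LEAST d. R d)"
  have "R n"
    using n closed by (auto simp: R_def)
  then have "R d"
    unfolding d_def by (rule LeastI)
  then obtain i where d: "d > 0" and i: "i + d \<le> n" "w (i + d) = w i"
    by (auto simp: R_def)
  have min: "\<not> R d'" if "d' < d" for d'
    using that not_less_Least unfolding d_def by blast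
  have "d \<noteq> 1"
  proof
    assume "d = 1"
    then have "(w i, w i) \<in> adj T"
      using walk[of i] i by simp
    then show False
      using T by (auto simp: is_graph_def irrefl_def)
  qed
  moreover have "\<not> d \<ge> 3"
  proof
    assume d3: "d \<ge> 3"
    have inj: "w a \<noteq> w b" if "i \<le> a" "a < b" "b < i + d" for a b
    proof -
      have "b - a < d" "b - a > 0" "a + (b - a) = b" "b \<le> n"
        using that i by auto
      then show ?thesis
        using min[of "b - a"] unfolding R_def by metis
    qed
    have "is_cycle T (map w [i..<i + d])"
      unfolding is_cycle_def
    proof (intro conjI allI impI)
      show "3 \<le> length (map w [i..<i + d])"
        using d3 by simp
      show "distinct (map w [i..<i + d])"
        unfolding distinct_map by (auto simp: inj_on_def) (metis inj linorder_neqE_nat)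
      fix k assume k: "k < length (map w [i..<i + d])"
      show "(map w [i..<i + d] ! k, map w [i..<i + d] ! (Suc k mod length (map w [i..<i + d]))) \<in> adj T"
      \<comment> \<open>The closing edge of the cycle is the last step of the stretch: the index
        wraps around to 0, and \<open>w (i + d) = w i\<close>.\<close>
      proof (cases "Suc k = d")
        case True
        then have "Suc (i + k) = i + d"
          by simp
        then show ?thesis
          using walk[of "i + k"] i k True by (metis add_0_right add_lessD1 length_map length_upt mod_self
            nth_map nth_upt add_diff_cancel_left' d less_add_same_cancel1 lessI order_less_le_trans)
      next
        case False
        then show ?thesis
          using walk[of "i + k"] i k by simp
      qed
    qed
    then show False
      using acyc by blast
  qed
  ultimately have "d = 2"
    using d by linarith
  then show ?thesis
    using i by blast
qed

text \<open>A zigzag in \<open>int_cat T\<close> moves between bags and adhesions. Contracting each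
  passage through an adhesion gives one step between adjacent bags, so the zigzag projects to a walk
  in \<open>T\<close>; the condition \<open>x \<noteq> y\<close> keeps out steps that stay in
  place.\<close>

definition vert_step where
  "vert_step T U F = {((x, fun_of (farr F (Incl e x)) s), (y, fun_of (farr F (Incl e y)) s)) | e x y s.
     e \<in> edge_set T \<and> x \<in> e \<and> y \<in> e \<and> x \<noteq> y \<and> s \<in> U (fobj F (Edge e))}"

text \<open>A closed walk in a tree backtracks somewhere, and by injectivity of the maps of the adhesions
  a walk of elements that backtracks returns to the element it came from.\<close>

lemma vert_step_closed:
  assumes T: "T \<in> Trees"
    and inj: "\<And>e x. e \<in> edge_set T \<Longrightarrow> x \<in> e \<Longrightarrow> inj_on (fun_of (farr F (Incl e x))) (U (fobj F (Edge e)))"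
    and "(p, q) \<in> vert_step T U F ^^ n" "fst p = fst q"
  shows "p = q"
  using assms(3,4)
proof (induction n rule: less_induct)
  case (less n)
  have G: "is_graph T" and acyc: "\<nexists>xs. is_cycle T xs"
    using T by (auto simp: Trees_def)
  show ?case
  proof (cases "n = 0")
    case True
    then show ?thesis using less.prems by simp
  next
    case False
    obtain f where f: "f 0 = p" "f n = q" and st: "\<And>k. k < n \<Longrightarrow> (f k, f (Suc k)) \<in> vert_step T U F"
      using less.prems(1) unfolding relpow_fun_conv by blast
    have "(fst (f k), fst (f (Suc k))) \<in> adj T" if "k < n" for k
      using st[OF that] edge_set_adj(1)[OF G] unfolding vert_step_def by auto
    then obtain k where k: "k + 2 \<le> n" "fst (f (k + 2)) = fst (f k)"
      using closed_walk_backtrack[OF G acyc, of n "\<lambda>k. fst (f k)"] False f less.prems(2) by auto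
    \<comment> \<open>This step and the next cross the same edge in opposite directions. They agree
      at the bag in the middle, so by injectivity they come from the same adhesion element, and the
      second undoes the first.\<close>
    obtain e x y s where 1: "f k = (x, fun_of (farr F (Incl e x)) s)"
      "f (Suc k) = (y, fun_of (farr F (Incl e y)) s)"
      "e \<in> edge_set T" "x \<in> e" "y \<in> e" "x \<noteq> y" "s \<in> U (fobj F (Edge e))"
      using st[of k] k unfolding vert_step_def by auto
    obtain e' x' y' s' where 2: "f (Suc k) = (y', fun_of (farr F (Incl e' y')) s')"
      "f (Suc (Suc k)) = (x', fun_of (farr F (Incl e' x')) s')"
      "e' \<in> edge_set T" "x' \<in> e'" "y' \<in> e'" "x' \<noteq> y'" "s' \<in> U (fobj F (Edge e'))"
      using st[of "Suc k"] k unfolding vert_step_def by auto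
    have eqs: "x' = x" "y' = y"
      using 1 2 k by simp_all
    then have "e = e'"
      using edge_set_adj(2)[OF G 1(3,4,5,6)] edge_set_adj(2)[OF G 2(3,4,5,6)] by simp
    with eqs 1 2 have "s = s'"
      using inj[OF 1(3,5)] by (auto dest: inj_onD)
    with eqs \<open>e = e'\<close> 1 2 have bt: "f (k + 2) = f k"
      by simp
    \<comment> \<open>With the two backtracking steps cut out, a walk of length \<open>n - 2\<close>
      with the same ends remains.\<close>
    have "(p, f k) \<in> vert_step T U F ^^ k"
      unfolding relpow_fun_conv using f st k by (intro exI[of _ f]) auto
    moreover have "(f (k + 2), q) \<in> vert_step T U F ^^ (n - (k + 2))"
      unfolding relpow_fun_conv
    proof (intro exI conjI allI impI)
      show "f (k + 2 + (n - (k + 2))) = q"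
        using f k by (metis le_add_diff_inverse)
    qed (use st in auto)
    ultimately have "(p, q) \<in> vert_step T U F ^^ (k + (n - (k + 2)))"
      unfolding relpow_add bt by blast
    then show ?thesis
      using less.IH[of "k + (n - (k + 2))"] k less.prems(2) by auto
  qed
qed

text \<open>An adhesion element is represented by its images in the bags at both ends of the edge,
  so that a zigzag that starts or ends in an adhesion can also be compared with a walk between
  bags.\<close>

fun vert_reps where
  "vert_reps F (Vert x, a) = {(x, a)}"
| "vert_reps F (Edge e, a) = {(x, fun_of (farr F (Incl e x)) a) | x. x \<in> e}"

text \<open>Claiming the relation for all representatives makes the induction work: entering a bag
  from an adhesion gives no new representative, and returning to the adhesion costs at most one
  \<open>vert_step\<close>, to the other end. The hypothesis on \<open>IdArr\<close> makes identity
  arrows harmless.\<close>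

lemma vert_reps_steps:
  assumes G: "is_graph T" and F: "\<And>i y. i \<in> Obj (int_cat T) \<Longrightarrow> y \<in> U (fobj F i) \<Longrightarrow> fun_of (farr F (IdArr i)) y = y"
    and eq: "((i, a), (j, b)) \<in> elem_eq (int_cat T) U F"
    and i: "i \<in> Obj (int_cat T)" "a \<in> U (fobj F i)"
    and p: "p \<in> vert_reps F (i, a)" and q: "q \<in> vert_reps F (j, b)"
  shows "(p, q) \<in> (vert_step T U F)\<^sup>*"
  using eq q
proof (induction arbitrary: q rule: elem_eq_induct)
  case refl
  show ?case
  proof (cases i)
    case (Vert x)
    then show ?thesis using p refl by simp
  next
    case (Edge e)
    then obtain x y where xy: "p = (x, fun_of (farr F (Incl e x)) a)" "x \<in> e"
      "q = (y, fun_of (farr F (Incl e y)) a)" "y \<in> e"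
      using p refl by auto
    show ?thesis
    proof (cases "x = y")
      case False
      have "e \<in> edge_set T"
        using i Edge by (auto simp: Obj_int_cat)
      then have "(p, q) \<in> vert_step T U F"
        using xy False i(2) Edge unfolding vert_step_def by blast
      then show ?thesis ..
    qed (use xy in simp)
  qed
next
  case (fwd k x)
  show ?case
  proof (cases k)
    case (IdArr j)
    then show ?thesis
      using fwd F[of j x] by (cases q) (auto simp: Arr_int_cat)
  next
    case (Incl e v)
    then have "q \<in> vert_reps F (Dom (int_cat T) k, x)"
      using fwd by (auto simp: Arr_int_cat)
    then show ?thesis
      using fwd by simp
  qed
next
  case (bwd k x)
  show ?case
  proof (cases k)
    case (IdArr j)
    then show ?thesis
      using bwd F[of j x] by (cases q) (auto simp: Arr_int_cat)
  next
    case (Incl e v)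
    let ?r = "(v, fun_of (farr F k) x)"
    obtain u where u: "q = (u, fun_of (farr F (Incl e u)) x)" "u \<in> e" and e: "e \<in> edge_set T" "v \<in> e"
      using bwd Incl by (auto simp: Arr_int_cat)
    have "(p, ?r) \<in> (vert_step T U F)\<^sup>*"
      using bwd.IH[of ?r] Incl by simp
    moreover have "(?r, q) \<in> (vert_step T U F)\<^sup>*"
    proof (cases "u = v")
      case False
      then have "(?r, q) \<in> vert_step T U F"
        using u e Incl bwd(2) unfolding vert_step_def by auto
      then show ?thesis ..
    qed (use u Incl in simp)
    ultimately show ?thesis by simp
  qed
qed

text \<open>Representatives over the same vertex of \<open>T\<close> coincide by the closed-walk
  argument. In a bag these are the elements themselves; in an adhesion they are the images at one
  end, and injectivity there finishes.\<close>

lemma tree_elem_eq_same_node: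
  assumes T: "T \<in> Trees"
    and F: "\<And>i y. i \<in> Obj (int_cat T) \<Longrightarrow> y \<in> U (fobj F i) \<Longrightarrow> fun_of (farr F (IdArr i)) y = y"
    and inj: "\<And>e x. e \<in> edge_set T \<Longrightarrow> x \<in> e \<Longrightarrow> inj_on (fun_of (farr F (Incl e x))) (U (fobj F (Edge e)))"
    and eq: "((i, a), (i, b)) \<in> elem_eq (int_cat T) U F"
    and i: "i \<in> Obj (int_cat T)" "a \<in> U (fobj F i)" "b \<in> U (fobj F i)"
  shows "a = b"
proof -
  have G: "is_graph T"
    using T by (auto simp: Trees_def)
  have *: "p = q" if "p \<in> vert_reps F (i, a)" "q \<in> vert_reps F (i, b)" "fst p = fst q" for p q
  proof -
    have "(p, q) \<in> (vert_step T U F)\<^sup>*"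
      by (rule vert_reps_steps[OF G F eq i(1,2) that(1,2)])
    then show ?thesis
      using vert_step_closed[OF T inj _ that(3)] by (metis rtrancl_power)
  qed
  show ?thesis
  proof (cases i)
    case (Vert x)
    then show ?thesis using *[of "(x, a)" "(x, b)"] by simp
  next
    case (Edge e)
    then have e: "e \<in> edge_set T"
      using i by (auto simp: Obj_int_cat)
    then obtain x where x: "x \<in> e"
      using G by (auto elim: edge_setE)
    have "fun_of (farr F (Incl e x)) a = fun_of (farr F (Incl e x)) b"
      using *[of "(x, fun_of (farr F (Incl e x)) a)" "(x, fun_of (farr F (Incl e x)) b)"] Edge x by auto
    then show ?thesis
      using inj[OF e x] i Edge by (auto dest: inj_onD)
  qed
qed

section \<open>Pullbacks of layered graphs\<close>

definition layered_graphs :: "lgraph set" where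
  "layered_graphs = {X. is_graph (fst X) \<and> layering (fst X) (snd X)}"

definition layered_hom :: "lgraph \<Rightarrow> lgraph \<Rightarrow> (nat \<Rightarrow> nat) \<Rightarrow> bool" where
  "layered_hom X Y f \<longleftrightarrow>
     edge_preserving (fst X) (fst Y) f \<and> (\<forall>x\<in>verts (fst X). snd Y (f x) = snd X x)"

interpretation Gr: concrete "{G. is_graph G}" verts edge_preserving Gr
  by unfold_locales (auto simp: Gr_def edge_preserving_def is_graph_def compose_def split: prod.splits)

interpretation Lyr: concrete layered_graphs "\<lambda>X. verts (fst X)" layered_hom GrLyr
proof
  have 1: "layered_graphs = {(G, L) | G L. is_graph G \<and> layering G L}"
    by (auto simp: layered_graphs_def)
  have 2: "(\<lambda>X. verts (fst X)) = (\<lambda>(G, L). verts G)"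
    by (auto simp: fun_eq_iff)
  have 3: "layered_hom = (\<lambda>(G, L) (H, M) f. edge_preserving G H f \<and> (\<forall>x\<in>verts G. M (f x) = L x))"
    by (auto simp: fun_eq_iff layered_hom_def)
  show "GrLyr = concrete_cat layered_graphs (\<lambda>X. verts (fst X)) layered_hom"
    unfolding GrLyr_def 1 2 3 ..
next
  fix A
  show "A \<in> layered_graphs \<Longrightarrow> layered_hom A A (\<lambda>x\<in>verts (fst A). x)"
    by (auto simp: layered_graphs_def layered_hom_def edge_preserving_def is_graph_def)
next
  fix A B D f g
  assume A: "A \<in> layered_graphs" and f: "f \<in> verts (fst A) \<rightarrow>\<^sub>E verts (fst B)"
    and hom: "layered_hom A B f" "layered_hom B D g"
  have "x \<in> verts (fst A) \<and> y \<in> verts (fst A)" if "(x, y) \<in> adj (fst A)" for x y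
    using A that by (auto simp: layered_graphs_def is_graph_def)
  then show "layered_hom A D (compose (verts (fst A)) g f)"
    using hom f by (fastforce simp: layered_hom_def edge_preserving_def compose_def PiE_iff)
qed

lemma Lyr_homI:
  assumes "A \<in> layered_graphs" "B \<in> layered_graphs"
    "\<And>x. x \<in> verts (fst A) \<Longrightarrow> f x \<in> verts (fst B)"
    "\<And>x y. (x, y) \<in> adj (fst A) \<Longrightarrow> (f x, f y) \<in> adj (fst B)"
    "\<And>x. x \<in> verts (fst A) \<Longrightarrow> snd B (f x) = snd A x"
  shows "(A, restrict f (verts (fst A)), B) \<in> hom GrLyr A B"
proof (rule Lyr.homI)
  show "layered_hom A B (restrict f (verts (fst A)))"
    using assms by (fastforce simp: layered_hom_def edge_preserving_def layered_graphs_def is_graph_def)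
qed (use assms in auto)

lemma Lyr_hom_edge:
  "a \<in> hom GrLyr A B \<Longrightarrow> (x, y) \<in> adj (fst A) \<Longrightarrow> (fun_of a x, fun_of a y) \<in> adj (fst B)"
  by (auto simp: Lyr.hom_iff layered_hom_def edge_preserving_def)

lemma Lyr_hom_layer:
  "a \<in> hom GrLyr A B \<Longrightarrow> x \<in> verts (fst A) \<Longrightarrow> snd B (fun_of a x) = snd A x"
  by (auto simp: Lyr.hom_iff layered_hom_def)

lemma layered_adj:
  assumes "X \<in> layered_graphs" "(x, y) \<in> adj (fst X)"
  shows "x \<in> verts (fst X)" "y \<in> verts (fst X)" "x \<noteq> y" "(y, x) \<in> adj (fst X)"
    "\<bar>int (snd X x) - int (snd X y)\<bar> \<le> 1"
  using assms by (auto simp: layered_graphs_def is_graph_def layering_def irrefl_def dest: symD)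

lemma layered_finite: "X \<in> layered_graphs \<Longrightarrow> finite (verts (fst X))"
  by (auto simp: layered_graphs_def is_graph_def)

text \<open>The constructions below produce pairs and equivalence classes as vertices, whereas
  objects have initial segments of the naturals as vertex sets. Numbering the vertices by a
  bijection \<open>h\<close> transports edges and layers, and injectivity of \<open>h\<close>
  creates no loops.\<close>

lemma layered_graph_skeleton:
  fixes V :: "'v set"
  assumes "finite V" "E \<subseteq> V \<times> V" "sym E" "irrefl E"
    and L: "\<And>x y. (x, y) \<in> E \<Longrightarrow> \<bar>int (L x) - int (L y)\<bar> \<le> 1"
  obtains X h where "X \<in> layered_graphs" "bij_betw h V (verts (fst X))"
    "adj (fst X) = {(h x, h y) | x y. (x, y) \<in> E}" "\<And>x. x \<in> V \<Longrightarrow> snd X (h x) = L x"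
proof -
  obtain h where h: "bij_betw h V {0..<card V}"
    using ex_bij_betw_finite_nat[OF \<open>finite V\<close>] by blast
  then have h': "bij_betw h V {..<card V}"
    by (simp add: atLeast0LessThan)
  define M where "M = (\<lambda>z\<in>{..<card V}. L (inv_into V h z))"
  have inv: "inv_into V h (h x) = x" if "x \<in> V" for x
    using h' that by (simp add: bij_betw_inv_into_left)
  have hV: "h x \<in> {..<card V}" if "x \<in> V" for x
    using h' that by (rule bij_betwE[THEN bspec])
  have M: "M (h x) = L x" if "x \<in> V" for x
    unfolding M_def using inv[OF that] hV[OF that] by simp
  let ?E = "{(h x, h y) | x y. (x, y) \<in> E}"
  have inj: "x = y" if "x \<in> V" "y \<in> V" "h x = h y" for x y
    using that inv by metis
  have g: "is_graph \<lparr>verts = {..<card V}, adj = ?E\<rparr>"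
    unfolding is_graph_def
  proof (intro conjI)
    show "adj \<lparr>verts = {..<card V}, adj = ?E\<rparr>
      \<subseteq> verts \<lparr>verts = {..<card V}, adj = ?E\<rparr> \<times> verts \<lparr>verts = {..<card V}, adj = ?E\<rparr>"
      using assms(2) hV by fastforce
    show "sym (adj \<lparr>verts = {..<card V}, adj = ?E\<rparr>)"
      using assms(3) by (fastforce simp: sym_def)
    show "irrefl (adj \<lparr>verts = {..<card V}, adj = ?E\<rparr>)"
      using assms(2,4) inj by (fastforce simp: irrefl_def)
  qed auto
  have l: "layering \<lparr>verts = {..<card V}, adj = ?E\<rparr> M"
    unfolding layering_def
  proof (intro conjI ballI)
    show "M \<in> extensional (verts \<lparr>verts = {..<card V}, adj = ?E\<rparr>)"
      by (simp add: M_def)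
    fix z assume "z \<in> adj \<lparr>verts = {..<card V}, adj = ?E\<rparr>"
    then obtain x y where xy: "z = (h x, h y)" "(x, y) \<in> E"
      by auto
    then have "M (h x) = L x" "M (h y) = L y"
      using M assms(2) by auto
    then show "case z of (x, y) \<Rightarrow> \<bar>int (M x) - int (M y)\<bar> \<le> 1"
      using L xy by simp
  qed
  show thesis
  proof (rule that[of "(\<lparr>verts = {..<card V}, adj = ?E\<rparr>, M)" h])
    show "(\<lparr>verts = {..<card V}, adj = ?E\<rparr>, M) \<in> layered_graphs"
      unfolding layered_graphs_def using g l by simp
  qed (use h' M in auto)
qed

section \<open>Test objects: a vertex in a layer, an edge between layers\<close>

definition layered_point :: "nat \<Rightarrow> lgraph" where
  "layered_point l = (\<lparr>verts = {..<1}, adj = {}\<rparr>, \<lambda>x\<in>{..<1}. l)"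

text \<open>Arrows out of \<open>layered_point l\<close> are the vertices in layer \<open>l\<close>,
  arrows out of \<open>layered_edge l m\<close> the edges from layer \<open>l\<close> to layer
  \<open>m\<close>. The latter is an object only if \<open>l\<close> and \<open>m\<close> differ by
  at most 1, as they do for the ends of an edge.\<close>

definition layered_edge :: "nat \<Rightarrow> nat \<Rightarrow> lgraph" where
  "layered_edge l m = (\<lparr>verts = {..<2}, adj = {(0, 1), (1, 0)}\<rparr>, \<lambda>x\<in>{..<2}. if x = 0 then l else m)"

lemma layered_point_hom:
  assumes A: "A \<in> layered_graphs" and x: "x \<in> verts (fst A)"
  defines "l \<equiv> snd A x"
  obtains a where "a \<in> hom GrLyr (layered_point l) A" "fun_of a 0 = x"
proof -
  have P: "layered_point l \<in> layered_graphs"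
    by (auto simp: layered_graphs_def layered_point_def is_graph_def layering_def sym_def irrefl_def)
  have "(layered_point l, \<lambda>y\<in>verts (fst (layered_point l)). x, A) \<in> hom GrLyr (layered_point l) A"
    by (rule Lyr_homI[OF P A]) (auto simp: layered_point_def x l_def)
  then show thesis
    by (rule that) (simp add: fun_of_def layered_point_def)
qed

lemma layered_edge_hom:
  assumes A: "A \<in> layered_graphs" and xy: "(x, y) \<in> adj (fst A)"
  defines "l \<equiv> snd A x" and "m \<equiv> snd A y"
  obtains a where "a \<in> hom GrLyr (layered_edge l m) A" "fun_of a 0 = x" "fun_of a 1 = y"
proof -
  have "\<bar>int l - int m\<bar> \<le> 1"
    using layered_adj(5)[OF A xy] by (simp add: l_def m_def)
  then have P: "layered_edge l m \<in> layered_graphs"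
    by (auto simp: layered_graphs_def layered_edge_def is_graph_def layering_def sym_def irrefl_def)
  have "(layered_edge l m, \<lambda>z\<in>verts (fst (layered_edge l m)). if z = 0 then x else y, A)
      \<in> hom GrLyr (layered_edge l m) A"
    by (rule Lyr_homI[OF P A])
      (use xy layered_adj[OF A xy] in \<open>auto simp: layered_edge_def l_def m_def split: if_splits\<close>)
  then show thesis
    by (rule that) (simp_all add: fun_of_def layered_edge_def)
qed

lemma verts_layered_point [simp]: "verts (fst (layered_point l)) = {0}"
  and verts_layered_edge [simp]: "verts (fst (layered_edge l m)) = {0, 1}"
  and adj_layered_edge: "adj (fst (layered_edge l m)) = {(0, 1), (1, 0)}"
  by (auto simp: layered_point_def layered_edge_def)

text \<open>For the direction from monic to injective: two vertices with the same image lie in the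
  same layer, hence both are arrows from the same \<open>layered_point\<close>, and \<open>f\<close>
  can be cancelled.\<close>

lemma Lyr_mono_iff:
  assumes f: "f \<in> hom GrLyr A B"
  shows "monomorphism GrLyr f \<longleftrightarrow> inj_on (fun_of f) (verts (fst A))"
proof
  assume m: "monomorphism GrLyr f"
  have A: "A \<in> layered_graphs"
    using Lyr.hom_obj[OF f] by simp
  show "inj_on (fun_of f) (verts (fst A))"
  proof (rule inj_onI)
    fix x y assume x: "x \<in> verts (fst A)" and y: "y \<in> verts (fst A)" and eq: "fun_of f x = fun_of f y"
    have l: "snd A y = snd A x"
      using Lyr_hom_layer[OF f x] Lyr_hom_layer[OF f y] eq by simp
    obtain a where a: "a \<in> hom GrLyr (layered_point (snd A x)) A" "fun_of a 0 = x"
      using layered_point_hom[OF A x] .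
    obtain b where b: "b \<in> hom GrLyr (layered_point (snd A x)) A" "fun_of b 0 = y"
      using layered_point_hom[OF A y] unfolding l .
    have "Comp GrLyr f a = Comp GrLyr f b"
      by (rule Lyr.hom_eqI[OF Lyr.comp_in_hom[OF a(1) f] Lyr.comp_in_hom[OF b(1) f]])
        (simp add: Lyr.fun_of_Comp[OF a(1) f] Lyr.fun_of_Comp[OF b(1) f] a b eq)
    then have "a = b"
      using m a(1) b(1) Lyr.hom_Arr[OF f] unfolding monomorphism_def by metis
    then show "x = y"
      using a b by simp
  qed
qed (rule Lyr.monoI[OF f])

text \<open>The fibre product of the vertex sets, an edge being a pair of edges, one in each factor.
  Both coordinates of a vertex have the same layer, because both arrows into \<open>B\<close>
  preserve layers, so the layering may be read off the first.\<close>

lemma Lyr_pullback_ex: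
  assumes f: "f \<in> hom GrLyr X B" and g: "g \<in> hom GrLyr Y B"
  shows "\<exists>P p q. pullback GrLyr f g P p q"
proof -
  have X: "X \<in> layered_graphs" and Y: "Y \<in> layered_graphs"
    using Lyr.hom_obj[OF f] Lyr.hom_obj[OF g] by auto
  define V where "V = {(x, y). x \<in> verts (fst X) \<and> y \<in> verts (fst Y) \<and> fun_of f x = fun_of g y}"
  define E where "E = {(a, b). a \<in> V \<and> b \<in> V \<and> (fst a, fst b) \<in> adj (fst X) \<and> (snd a, snd b) \<in> adj (fst Y)}"
  obtain P h where P: "P \<in> layered_graphs" and h: "bij_betw h V (verts (fst P))"
    and adjP: "adj (fst P) = {(h x, h y) | x y. (x, y) \<in> E}" and LP: "\<And>x. x \<in> V \<Longrightarrow> snd P (h x) = snd X (fst x)"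
  proof (rule layered_graph_skeleton[of V E "\<lambda>a. snd X (fst a)"])
    show "finite V"
      by (rule finite_subset[of _ "verts (fst X) \<times> verts (fst Y)"])
        (auto simp: V_def layered_finite[OF X] layered_finite[OF Y])
    show "E \<subseteq> V \<times> V"
      by (auto simp: E_def)
    show "sym E"
      using layered_adj(4)[OF X] layered_adj(4)[OF Y] by (auto simp: E_def sym_def)
    show "irrefl E"
      using layered_adj(3)[OF X] by (auto simp: E_def irrefl_def)
    show "\<And>x y. (x, y) \<in> E \<Longrightarrow> \<bar>int (snd X (fst x)) - int (snd X (fst y))\<bar> \<le> 1"
      using layered_adj(5)[OF X] by (auto simp: E_def)
  qed (rule that)
  define k where "k = inv_into V h"
  have kh: "k (h a) = a" if "a \<in> V" for a
    using h that by (simp add: bij_betw_inv_into_left k_def)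
  have hk: "h (k z) = z" and kV: "k z \<in> V" if "z \<in> verts (fst P)" for z
    using h that by (simp_all add: k_def bij_betw_inv_into_right bij_betw_def inv_into_into)
  have hV: "h a \<in> verts (fst P)" if "a \<in> V" for a
    using h that by (rule bij_betwE[THEN bspec])
  have kE: "(k z, k z') \<in> E" if "(z, z') \<in> adj (fst P)" for z z'
    using that kh unfolding adjP by (auto simp: E_def)
  define p where "p = (P, restrict (\<lambda>z. fst (k z)) (verts (fst P)), X)"
  define q where "q = (P, restrict (\<lambda>z. snd (k z)) (verts (fst P)), Y)"
  have LY: "snd Y (snd a) = snd X (fst a)" if "a \<in> V" for a
    using that Lyr_hom_layer[OF f] Lyr_hom_layer[OF g] unfolding V_def by fastforce
  have p: "p \<in> hom GrLyr P X"
    unfolding p_def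
  proof (rule Lyr_homI[OF P X])
    fix z assume z: "z \<in> verts (fst P)"
    show "fst (k z) \<in> verts (fst X)"
      using kV[OF z] by (auto simp: V_def)
    show "snd X (fst (k z)) = snd P z"
      using LP[OF kV[OF z]] hk[OF z] by simp
  next
    fix z z' assume "(z, z') \<in> adj (fst P)"
    then show "(fst (k z), fst (k z')) \<in> adj (fst X)"
      using kE by (auto simp: E_def)
  qed
  have q: "q \<in> hom GrLyr P Y"
    unfolding q_def
  proof (rule Lyr_homI[OF P Y])
    fix z assume z: "z \<in> verts (fst P)"
    show "snd (k z) \<in> verts (fst Y)"
      using kV[OF z] by (auto simp: V_def)
    show "snd Y (snd (k z)) = snd P z"
      using LP[OF kV[OF z]] hk[OF z] LY[OF kV[OF z]] by simp
  next
    fix z z' assume "(z, z') \<in> adj (fst P)"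
    then show "(snd (k z), snd (k z')) \<in> adj (fst Y)"
      using kE by (auto simp: E_def)
  qed
  have pf: "fun_of p z = fst (k z)" and qf: "fun_of q z = snd (k z)" if "z \<in> verts (fst P)" for z
    using that by (simp_all add: p_def q_def fun_of_def)
  have fD: "f \<in> Arr GrLyr" "Dom GrLyr f = X" "Cod GrLyr f = B"
    and gD: "g \<in> Arr GrLyr" "Dom GrLyr g = Y" "Cod GrLyr g = B"
    using f g by (auto simp: hom_def)
  have "pullback GrLyr f g P p q"
    unfolding pullback_def fD gD
  proof (intro conjI allI ballI impI)
    show "Comp GrLyr f p = Comp GrLyr g q"
    proof (rule Lyr.hom_eqI[OF Lyr.comp_in_hom[OF p f] Lyr.comp_in_hom[OF q g]])
      fix z assume z: "z \<in> verts (fst P)"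
      show "fun_of (Comp GrLyr f p) z = fun_of (Comp GrLyr g q) z"
        using kV[OF z] by (auto simp: Lyr.fun_of_Comp[OF p f z] Lyr.fun_of_Comp[OF q g z] pf[OF z] qf[OF z] V_def)
    qed
    fix Q r s
    assume r: "r \<in> hom GrLyr Q X" and s: "s \<in> hom GrLyr Q Y" and rs: "Comp GrLyr f r = Comp GrLyr g s"
    have Q: "Q \<in> layered_graphs"
      using Lyr.hom_obj[OF r] by simp
    have V: "(fun_of r z, fun_of s z) \<in> V" if "z \<in> verts (fst Q)" for z
      using Lyr.fun_of_Comp[OF r f that] Lyr.fun_of_Comp[OF s g that] rs
        Lyr.fun_of_in[OF r that] Lyr.fun_of_in[OF s that] by (simp add: V_def)
    define u where "u = (Q, restrict (\<lambda>z. h (fun_of r z, fun_of s z)) (verts (fst Q)), P)"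
    have u: "u \<in> hom GrLyr Q P"
      unfolding u_def
    proof (rule Lyr_homI[OF Q P])
      fix z assume z: "z \<in> verts (fst Q)"
      show "h (fun_of r z, fun_of s z) \<in> verts (fst P)"
        by (rule hV[OF V[OF z]])
      show "snd P (h (fun_of r z, fun_of s z)) = snd Q z"
        using LP[OF V[OF z]] Lyr_hom_layer[OF r z] by simp
    next
      fix z z' assume e: "(z, z') \<in> adj (fst Q)"
      have "((fun_of r z, fun_of s z), (fun_of r z', fun_of s z')) \<in> E"
        using V layered_adj(1,2)[OF Q e] Lyr_hom_edge[OF r e] Lyr_hom_edge[OF s e] by (simp add: E_def)
      then show "(h (fun_of r z, fun_of s z), h (fun_of r z', fun_of s z')) \<in> adj (fst P)"
        unfolding adjP by blast
    qed
    have uf: "fun_of u z = h (fun_of r z, fun_of s z)" if "z \<in> verts (fst Q)" for z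
      using that by (simp add: u_def fun_of_def)
    have uP: "fun_of p (fun_of u z) = fun_of r z" "fun_of q (fun_of u z) = fun_of s z"
      if "z \<in> verts (fst Q)" for z
      using that by (simp_all add: uf pf qf hV V kh)
    show "\<exists>!u. u \<in> hom GrLyr Q P \<and> Comp GrLyr p u = r \<and> Comp GrLyr q u = s"
    proof (rule ex1I[of _ u], intro conjI u)
      show "Comp GrLyr p u = r"
        by (rule Lyr.hom_eqI[OF Lyr.comp_in_hom[OF u p] r]) (simp add: Lyr.fun_of_Comp[OF u p] uP)
      show "Comp GrLyr q u = s"
        by (rule Lyr.hom_eqI[OF Lyr.comp_in_hom[OF u q] s]) (simp add: Lyr.fun_of_Comp[OF u q] uP)
    next
      fix v assume v: "v \<in> hom GrLyr Q P \<and> Comp GrLyr p v = r \<and> Comp GrLyr q v = s"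
      then have vh: "v \<in> hom GrLyr Q P" ..
      show "v = u"
      proof (rule Lyr.hom_eqI[OF vh u])
        fix z assume z: "z \<in> verts (fst Q)"
        have w: "fun_of v z \<in> verts (fst P)"
          by (rule Lyr.fun_of_in[OF vh z])
        have "k (fun_of v z) = (fun_of r z, fun_of s z)"
          using Lyr.fun_of_Comp[OF vh p z] Lyr.fun_of_Comp[OF vh q z] v pf[OF w] qf[OF w]
          by (simp add: prod_eq_iff)
        then show "fun_of v z = fun_of u z"
          using hk[OF w] uf[OF z] by simp
      qed
    qed
  qed (use P p q fD gD in simp_all)
  then show ?thesis by blast
qed

text \<open>Edges with the same image have the same layers at corresponding ends, so both are arrows
  from one \<open>layered_edge\<close>. These agree over \<open>B\<close>, and the induced arrow
  sends the test edge to the required edge.\<close>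

lemma Lyr_pullback_edge:
  assumes pb: "pullback GrLyr f g P p q" and f: "f \<in> hom GrLyr X B" and g: "g \<in> hom GrLyr Y B"
    and xx: "(x, x') \<in> adj (fst X)" and yy: "(y, y') \<in> adj (fst Y)"
    and eq: "fun_of f x = fun_of g y" "fun_of f x' = fun_of g y'"
  obtains z z' where "(z, z') \<in> adj (fst P)" "fun_of p z = x" "fun_of p z' = x'"
proof -
  have X: "X \<in> layered_graphs" and Y: "Y \<in> layered_graphs"
    using Lyr.hom_obj[OF f] Lyr.hom_obj[OF g] by auto
  have l: "snd Y y = snd X x" "snd Y y' = snd X x'"
    using Lyr_hom_layer[OF f layered_adj(1)[OF X xx]] Lyr_hom_layer[OF f layered_adj(2)[OF X xx]]
      Lyr_hom_layer[OF g layered_adj(1)[OF Y yy]] Lyr_hom_layer[OF g layered_adj(2)[OF Y yy]] eq by simp_all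
  obtain r where r: "r \<in> hom GrLyr (layered_edge (snd X x) (snd X x')) X" "fun_of r 0 = x" "fun_of r 1 = x'"
    using layered_edge_hom[OF X xx] .
  obtain s where s: "s \<in> hom GrLyr (layered_edge (snd X x) (snd X x')) Y" "fun_of s 0 = y" "fun_of s 1 = y'"
    using layered_edge_hom[OF Y yy] unfolding l .
  have "Comp GrLyr f r = Comp GrLyr g s"
    by (rule Lyr.hom_eqI[OF Lyr.comp_in_hom[OF r(1) f] Lyr.comp_in_hom[OF s(1) g]])
      (use r s eq in \<open>auto simp: Lyr.fun_of_Comp[OF r(1) f] Lyr.fun_of_Comp[OF s(1) g]\<close>)
  moreover have D: "Dom GrLyr f = X" "Dom GrLyr g = Y"
    using f g by (auto simp: hom_def)
  ultimately obtain u where u: "u \<in> hom GrLyr (layered_edge (snd X x) (snd X x')) P" "Comp GrLyr p u = r"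
    using pb r(1) s(1) unfolding pullback_def by metis
  have p: "p \<in> hom GrLyr P X"
    using pb D by (simp add: pullback_def)
  show thesis
  proof (rule that)
    show "(fun_of u 0, fun_of u 1) \<in> adj (fst P)"
      by (rule Lyr_hom_edge[OF u(1)]) (simp add: adj_layered_edge)
    show "fun_of p (fun_of u 0) = x" "fun_of p (fun_of u 1) = x'"
      using Lyr.fun_of_Comp[OF u(1) p] u(2) r(2,3) by auto
  qed
qed

text \<open>Existence and uniqueness of \<open>z\<close> are existence and uniqueness of the arrow
  induced from a \<open>layered_point\<close>.\<close>

lemma Lyr_pullback_elem:
  assumes pb: "pullback GrLyr f g P p q" and f: "f \<in> hom GrLyr X B" and g: "g \<in> hom GrLyr Y B"
    and x: "x \<in> verts (fst X)" and y: "y \<in> verts (fst Y)" and eq: "fun_of f x = fun_of g y"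
  shows "\<exists>!z. z \<in> verts (fst P) \<and> fun_of p z = x \<and> fun_of q z = y"
proof -
  let ?O = "layered_point (snd X x)"
  have X: "X \<in> layered_graphs" and Y: "Y \<in> layered_graphs"
    using Lyr.hom_obj[OF f] Lyr.hom_obj[OF g] by auto
  have l: "snd Y y = snd X x"
    using Lyr_hom_layer[OF f x] Lyr_hom_layer[OF g y] eq by simp
  obtain r where r: "r \<in> hom GrLyr ?O X" "fun_of r 0 = x"
    using layered_point_hom[OF X x] .
  obtain s where s: "s \<in> hom GrLyr ?O Y" "fun_of s 0 = y"
    using layered_point_hom[OF Y y] unfolding l .
  have "Comp GrLyr f r = Comp GrLyr g s"
    by (rule Lyr.hom_eqI[OF Lyr.comp_in_hom[OF r(1) f] Lyr.comp_in_hom[OF s(1) g]])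
      (use r s eq in \<open>auto simp: Lyr.fun_of_Comp[OF r(1) f] Lyr.fun_of_Comp[OF s(1) g]\<close>)
  moreover have D: "Dom GrLyr f = X" "Dom GrLyr g = Y"
    using f g by (auto simp: hom_def)
  ultimately have ex: "\<exists>!u. u \<in> hom GrLyr ?O P \<and> Comp GrLyr p u = r \<and> Comp GrLyr q u = s"
    using pb r(1) s(1) unfolding pullback_def by metis
  have p: "p \<in> hom GrLyr P X" and q: "q \<in> hom GrLyr P Y"
    using pb D by (simp_all add: pullback_def)
  have P: "P \<in> layered_graphs"
    using Lyr.hom_obj[OF p] by simp
  obtain u where u: "u \<in> hom GrLyr ?O P" "Comp GrLyr p u = r" "Comp GrLyr q u = s"
    using ex by blast
  show ?thesis
  proof (rule ex1I[of _ "fun_of u 0"], intro conjI)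
    show "fun_of u 0 \<in> verts (fst P)"
      by (rule Lyr.fun_of_in[OF u(1)]) simp
    show "fun_of p (fun_of u 0) = x" "fun_of q (fun_of u 0) = y"
      using Lyr.fun_of_Comp[OF u(1) p, of 0] Lyr.fun_of_Comp[OF u(1) q, of 0] u r s by auto
  next
    fix z assume z: "z \<in> verts (fst P) \<and> fun_of p z = x \<and> fun_of q z = y"
    then have l: "snd P z = snd X x"
      using Lyr_hom_layer[OF p] by metis
    obtain v where v: "v \<in> hom GrLyr ?O P" "fun_of v 0 = z"
      using layered_point_hom[OF P conjunct1[OF z]] unfolding l .
    have "Comp GrLyr p v = r"
      by (rule Lyr.hom_eqI[OF Lyr.comp_in_hom[OF v(1) p] r(1)])
        (use r v z in \<open>simp add: Lyr.fun_of_Comp[OF v(1) p]\<close>)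
    moreover have "Comp GrLyr q v = s"
      by (rule Lyr.hom_eqI[OF Lyr.comp_in_hom[OF v(1) q] s(1)])
        (use s v z in \<open>simp add: Lyr.fun_of_Comp[OF v(1) q]\<close>)
    ultimately have "v = u"
      using ex u v by blast
    then show "z = fun_of u 0"
      using v by simp
  qed
qed

section \<open>Colimits of tree decompositions of layered graphs\<close>

text \<open>No clause speaks of layers: the maps of a cocone preserve them and are jointly onto, so
  the layering of \<open>X\<close> is determined by the diagram.\<close>

definition layered_colimit :: "('j, 'k) cat \<Rightarrow> ('j, 'k, lgraph, larrow) diagram \<Rightarrow>
    lgraph \<Rightarrow> ('j \<Rightarrow> larrow) \<Rightarrow> bool" where
  "layered_colimit J F X c \<longleftrightarrow>
     set_colimit J (\<lambda>X. verts (fst X)) F X c \<and>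
     (\<forall>x y. (x, y) \<in> adj (fst X) \<longrightarrow> (\<exists>i\<in>Obj J. \<exists>a b. (a, b) \<in> adj (fst (fobj F i)) \<and>
        fun_of (c i) a = x \<and> fun_of (c i) b = y))"

lemma layered_colimit_surj:
  assumes "layered_colimit J F X c" "x \<in> verts (fst X)"
  obtains i a where "i \<in> Obj J" "a \<in> verts (fst (fobj F i))" "fun_of (c i) a = x"
  using assms unfolding layered_colimit_def set_colimit_def by blast

lemma layered_colimit_adj:
  assumes "layered_colimit J F X c" "(x, y) \<in> adj (fst X)"
  obtains i a b where "i \<in> Obj J" "(a, b) \<in> adj (fst (fobj F i))" "fun_of (c i) a = x" "fun_of (c i) b = y"
  using assms unfolding layered_colimit_def by blast

lemma layered_colimit_glue:
  assumes "layered_colimit J F X c" "i \<in> Obj J" "j \<in> Obj J"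
    "a \<in> verts (fst (fobj F i))" "b \<in> verts (fst (fobj F j))" "fun_of (c i) a = fun_of (c j) b"
  shows "((i, a), (j, b)) \<in> elem_eq J (\<lambda>X. verts (fst X)) F"
  using assms unfolding layered_colimit_def set_colimit_def by blast

lemma layered_colimit_imp_colimit:
  assumes F: "is_functor J GrLyr F" and J: "category J" and c: "cocone J GrLyr F X c"
    and col: "layered_colimit J F X c"
  shows "colimit_cocone J GrLyr F X c"
proof (rule Lyr.set_colimit_imp_colimit[OF F J c])
  show "set_colimit J (\<lambda>X. verts (fst X)) F X c"
    using col by (simp add: layered_colimit_def)
  fix Y u
  assume hom: "\<And>i. i \<in> Obj J \<Longrightarrow>
    layered_hom (fobj F i) Y (compose (verts (fst (fobj F i))) u (fun_of (c i)))"
  show "layered_hom X Y u"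
    unfolding layered_hom_def edge_preserving_def
  proof (intro conjI ballI)
    fix x assume "x \<in> verts (fst X)"
    then obtain i a where "i \<in> Obj J" "a \<in> verts (fst (fobj F i))" "fun_of (c i) a = x"
      using layered_colimit_surj[OF col] by blast
    then show "snd Y (u x) = snd X x"
      using hom[of i] Lyr_hom_layer[OF Lyr.cocone_hom[OF c, of i]]
      by (auto simp: layered_hom_def compose_def)
  next
    fix e assume "e \<in> adj (fst X)"
    then obtain x y where e: "e = (x, y)" and "(x, y) \<in> adj (fst X)"
      by (cases e) auto
    then obtain i a b where i: "i \<in> Obj J" and ab: "(a, b) \<in> adj (fst (fobj F i))"
      "fun_of (c i) a = x" "fun_of (c i) b = y"
      using layered_colimit_adj[OF col] by blast
    have "fobj F i \<in> layered_graphs"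
      using Lyr.hom_obj[OF Lyr.cocone_hom[OF c i]] by simp
    then have "(u x, u y) \<in> adj (fst Y)"
      using hom[OF i] ab layered_adj[of "fobj F i" a b]
      by (force simp: layered_hom_def edge_preserving_def compose_def)
    then show "case e of (x, y) \<Rightarrow> (u x, u y) \<in> adj (fst Y)"
      by (simp add: e)
  qed
qed

text \<open>An edge of \<open>Y\<close> is sent to \<open>X\<close> by the comparison map, lifted
  there to a node of the diagram, and its lift is mapped back to \<open>Y\<close>.\<close>

lemma layered_colimit_transfer:
  assumes X: "colimit_cocone J GrLyr F X c" and Y: "colimit_cocone J GrLyr F Y e"
    and col: "layered_colimit J F X c"
  shows "layered_colimit J F Y e"
  unfolding layered_colimit_def
proof (intro conjI allI impI)
  show "set_colimit J (\<lambda>X. verts (fst X)) F Y e"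
    using Lyr.set_colimit_transfer[OF X Y] col by (simp add: layered_colimit_def)
  obtain u v where u: "u \<in> hom GrLyr Y X" and "v \<in> hom GrLyr X Y"
    and vu: "\<forall>y\<in>verts (fst Y). fun_of v (fun_of u y) = y"
    and vc: "\<forall>i\<in>Obj J. \<forall>a\<in>verts (fst (fobj F i)). fun_of v (fun_of (c i) a) = fun_of (e i) a"
    using Lyr.colimit_iso[OF Y X] by blast
  have Yo: "Y \<in> layered_graphs"
    using Lyr.hom_obj[OF u] by simp
  have F: "fobj F i \<in> layered_graphs" if "i \<in> Obj J" for i
    using X that Lyr.hom_obj unfolding colimit_cocone_def cocone_def by blast
  fix x y assume xy: "(x, y) \<in> adj (fst Y)"
  obtain i a b where i: "i \<in> Obj J" and ab: "(a, b) \<in> adj (fst (fobj F i))"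
    and eq: "fun_of (c i) a = fun_of u x" "fun_of (c i) b = fun_of u y"
    using layered_colimit_adj[OF col Lyr_hom_edge[OF u xy]] .
  have "fun_of (e i) a = x" "fun_of (e i) b = y"
    using vc i layered_adj(1,2)[OF F[OF i] ab] eq vu layered_adj(1,2)[OF Yo xy] by metis+
  then show "\<exists>i\<in>Obj J. \<exists>a b. (a, b) \<in> adj (fst (fobj F i)) \<and> fun_of (e i) a = x \<and> fun_of (e i) b = y"
    using i ab by blast
qed

text \<open>The core of (W3). Vertices and edges of \<open>X\<close> lift to the pullbacks because
  their images in \<open>Y\<close> lift to \<open>d\<close>. For the gluing, a zigzag of
  \<open>d\<close> over the image of a vertex \<open>x\<close> of \<open>X\<close> lifts to
  \<open>d'\<close>: at each node, \<open>x\<close> and the element there determine exactly one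
  vertex of the pullback, and the arrows of \<open>d'\<close> join consecutive lifts.\<close>

lemma layered_colimit_pullback:
  assumes J: "category J" and F: "is_functor J GrLyr d" and c: "cocone J GrLyr d Y c"
    and col: "layered_colimit J d Y c" and f: "f \<in> hom GrLyr X Y"
    and pb: "pullback_cocone J GrLyr d c f d' p q"
  shows "cocone J GrLyr d' X p" "layered_colimit J d' X p"
proof -
  have F': "is_functor J GrLyr d'"
    and pbi: "\<And>i. i \<in> Obj J \<Longrightarrow> pullback GrLyr f (c i) (fobj d' i) (p i) (q i)"
    and pk: "\<And>k. k \<in> Arr J \<Longrightarrow> Comp GrLyr (p (Cod J k)) (farr d' k) = p (Dom J k)"
    and qk: "\<And>k. k \<in> Arr J \<Longrightarrow> Comp GrLyr (q (Cod J k)) (farr d' k) = Comp GrLyr (farr d k) (q (Dom J k))"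
    using pb by (auto simp: pullback_cocone_def)
  note ch = Lyr.cocone_hom[OF c]
  have D: "Dom GrLyr f = X" "X \<in> layered_graphs"
    using f Lyr.hom_obj[OF f] by (auto simp: hom_def)
  have Dc: "Dom GrLyr (c i) = fobj d i" if "i \<in> Obj J" for i
    using ch[OF that] by (simp add: hom_def)
  have p: "p i \<in> hom GrLyr (fobj d' i) X" and q: "q i \<in> hom GrLyr (fobj d' i) (fobj d i)"
    and comm: "Comp GrLyr f (p i) = Comp GrLyr (c i) (q i)" if "i \<in> Obj J" for i
    using pbi[OF that] D Dc[OF that] by (auto simp: pullback_def)
  show coc: "cocone J GrLyr d' X p"
    using D p pk by (simp add: cocone_def)
  have fp: "fun_of f (fun_of (p i) z) = fun_of (c i) (fun_of (q i) z)"
    if "i \<in> Obj J" "z \<in> verts (fst (fobj d' i))" for i z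
    using Lyr.fun_of_Comp[OF p f] Lyr.fun_of_Comp[OF q ch] comm that by metis
  note pt = Lyr_pullback_elem[OF pbi f ch]
  show "layered_colimit J d' X p"
    unfolding layered_colimit_def set_colimit_def
  proof (intro conjI ballI allI impI)
    fix x assume x: "x \<in> verts (fst X)"
    obtain i a where i: "i \<in> Obj J" "a \<in> verts (fst (fobj d i))" "fun_of (c i) a = fun_of f x"
      using layered_colimit_surj[OF col Lyr.fun_of_in[OF f x]] .
    then show "\<exists>i\<in>Obj J. \<exists>a\<in>verts (fst (fobj d' i)). fun_of (p i) a = x"
      using pt[of i x a] x by metis
  next
    fix x y assume xy: "(x, y) \<in> adj (fst X)"
    obtain i a b where i: "i \<in> Obj J" and ab: "(a, b) \<in> adj (fst (fobj d i))"
      "fun_of (c i) a = fun_of f x" "fun_of (c i) b = fun_of f y"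
      using layered_colimit_adj[OF col Lyr_hom_edge[OF f xy]] .
    then show "\<exists>i\<in>Obj J. \<exists>a b. (a, b) \<in> adj (fst (fobj d' i)) \<and> fun_of (p i) a = x \<and> fun_of (p i) b = y"
      using Lyr_pullback_edge[OF pbi[OF i] f ch[OF i] xy ab(1)] i by metis
  next
    fix i j a b
    assume i: "i \<in> Obj J" and j: "j \<in> Obj J" and a: "a \<in> verts (fst (fobj d' i))"
      and b: "b \<in> verts (fst (fobj d' j))" and eq: "fun_of (p i) a = fun_of (p j) b"
    let ?x = "fun_of (p i) a"
    \<comment> \<open>The invariant along the zigzag: \<open>s\<close> lies over the image of
      \<open>?x\<close>, and the lift with coordinates \<open>?x\<close> and \<open>s\<close> is
      connected to the starting element. By \<open>pt\<close> there is exactly one such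
      \<open>z\<close>, so quantifying over all of them is not vacuous.\<close>
    define P where "P k s \<longleftrightarrow> k \<in> Obj J \<and> s \<in> verts (fst (fobj d k)) \<and> fun_of (c k) s = fun_of f ?x \<and>
      (\<forall>z\<in>verts (fst (fobj d' k)). fun_of (p k) z = ?x \<longrightarrow> fun_of (q k) z = s \<longrightarrow>
        ((i, a), (k, z)) \<in> elem_eq J (\<lambda>X. verts (fst X)) d')" for k s
    have P_elem: "((i, a), (k, z)) \<in> elem_eq J (\<lambda>X. verts (fst X)) d'"
      if "P k s" "z \<in> verts (fst (fobj d' k))" "fun_of (p k) z = ?x" "fun_of (q k) z = s" for k s z
      using that unfolding P_def by blast
    have x: "?x \<in> verts (fst X)"
      by (rule Lyr.fun_of_in[OF p[OF i] a])
    have eqd: "((i, fun_of (q i) a), (j, fun_of (q j) b)) \<in> elem_eq J (\<lambda>X. verts (fst X)) d"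
      by (rule layered_colimit_glue[OF col i j Lyr.fun_of_in[OF q[OF i] a] Lyr.fun_of_in[OF q[OF j] b]])
        (use fp[OF i a] fp[OF j b] eq in simp)
    have step: "fun_of (p (Cod J k)) (fun_of (farr d' k) z) = fun_of (p (Dom J k)) z"
      "fun_of (q (Cod J k)) (fun_of (farr d' k) z) = fun_of (farr d k) (fun_of (q (Dom J k)) z)"
      "fun_of (farr d' k) z \<in> verts (fst (fobj d' (Cod J k)))"
      if k: "k \<in> Arr J" and z: "z \<in> verts (fst (fobj d' (Dom J k)))" for k z
    proof -
      have D: "Dom J k \<in> Obj J" and C: "Cod J k \<in> Obj J"
        using category.dom_obj[OF J k] category.cod_obj[OF J k] by auto
      note h' = Lyr.farr_hom[OF F' k] and h = Lyr.farr_hom[OF F k]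
      show "fun_of (p (Cod J k)) (fun_of (farr d' k) z) = fun_of (p (Dom J k)) z"
        using Lyr.fun_of_Comp[OF h' p[OF C] z] pk[OF k] by simp
      show "fun_of (q (Cod J k)) (fun_of (farr d' k) z) = fun_of (farr d k) (fun_of (q (Dom J k)) z)"
        using Lyr.fun_of_Comp[OF h' q[OF C] z] Lyr.fun_of_Comp[OF q[OF D] h z] qk[OF k] by simp
      show "fun_of (farr d' k) z \<in> verts (fst (fobj d' (Cod J k)))"
        by (rule Lyr.fun_of_in[OF h' z])
    qed
    have "P j (fun_of (q j) b)"
      using eqd
    proof (induction rule: elem_eq_induct)
      case refl
      have s: "fun_of (q i) a \<in> verts (fst (fobj d i))"
        by (rule Lyr.fun_of_in[OF q[OF i] a])
      have "z = a" if "z \<in> verts (fst (fobj d' i))" "fun_of (p i) z = ?x" "fun_of (q i) z = fun_of (q i) a" for z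
        using pt[OF i i x s fp[OF i a]] that a by blast
      then show ?case
        unfolding P_def using i s fp[OF i a] elem_eq_refl by fastforce
    next
      case (fwd k s)
      have D: "Dom J k \<in> Obj J" and C: "Cod J k \<in> Obj J"
        using category.dom_obj[OF J fwd(1)] category.cod_obj[OF J fwd(1)] by auto
      let ?s = "fun_of (farr d k) s"
      have s: "?s \<in> verts (fst (fobj d (Cod J k)))"
        by (rule Lyr.fun_of_in[OF Lyr.farr_hom[OF F fwd(1)] fwd(2)])
      have cs: "fun_of (c (Cod J k)) ?s = fun_of f ?x"
        using Lyr.cocone_farr[OF F J c fwd(1,2)] fwd(3) by (simp add: P_def)
      \<comment> \<open>Forward, the lift at the source is pushed along \<open>farr d'\<close>; by
        uniqueness its image is the only lift of \<open>?s\<close>.\<close>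
      obtain z where z: "z \<in> verts (fst (fobj d' (Dom J k)))" "fun_of (p (Dom J k)) z = ?x" "fun_of (q (Dom J k)) z = s"
        using pt[OF D D x fwd(2)] fwd(3) unfolding P_def by metis
      have iz: "((i, a), (Dom J k, z)) \<in> elem_eq J (\<lambda>X. verts (fst X)) d'"
        by (rule P_elem[OF fwd(3) z])
      have "((i, a), (Cod J k, z')) \<in> elem_eq J (\<lambda>X. verts (fst X)) d'"
        if z': "z' \<in> verts (fst (fobj d' (Cod J k)))" "fun_of (p (Cod J k)) z' = ?x" "fun_of (q (Cod J k)) z' = ?s" for z'
      proof -
        have "z' = fun_of (farr d' k) z"
          using pt[OF C C x s cs[symmetric]] z' step[OF fwd(1) z(1)] z by metis
        then show ?thesis
          using elem_eq_trans[OF iz elem_eq_step[where U = "\<lambda>X. verts (fst X)", OF fwd(1) z(1)]] by simp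
      qed
      then show ?case
        unfolding P_def using C s cs by blast
    next
      case (bwd k s)
      have D: "Dom J k \<in> Obj J" and C: "Cod J k \<in> Obj J"
        using category.dom_obj[OF J bwd(1)] category.cod_obj[OF J bwd(1)] by auto
      have cs: "fun_of (c (Dom J k)) s = fun_of f ?x"
        using Lyr.cocone_farr[OF F J c bwd(1,2)] bwd(3) by (simp add: P_def)
      \<comment> \<open>Backward, the image of \<open>z\<close> under \<open>farr d'\<close> is the
        lift to which the invariant applies; the arrow is then traversed in reverse.\<close>
      have "((i, a), (Dom J k, z)) \<in> elem_eq J (\<lambda>X. verts (fst X)) d'"
        if z: "z \<in> verts (fst (fobj d' (Dom J k)))" "fun_of (p (Dom J k)) z = ?x" "fun_of (q (Dom J k)) z = s" for z
      proof -
        have "((i, a), (Cod J k, fun_of (farr d' k) z)) \<in> elem_eq J (\<lambda>X. verts (fst X)) d'"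
          by (rule P_elem[OF bwd(3) step(3)[OF bwd(1) z(1)]])
            (simp_all only: step(1,2)[OF bwd(1) z(1)] z(2,3))
        then show ?thesis
          by (rule elem_eq_trans[OF _ elem_eq_sym[OF elem_eq_step[where U = "\<lambda>X. verts (fst X)", OF bwd(1) z(1)]]])
      qed
      then show ?case
        unfolding P_def using D bwd(2) cs by blast
    qed
    then show "((i, a), (j, b)) \<in> elem_eq J (\<lambda>X. verts (fst X)) d'"
      by (rule P_elem) (use b eq in simp_all)
  qed
qed

section \<open>Tree decompositions of layered graphs\<close>

lemma Lyr_decomposition_functor:
  assumes "structured_decomposition GrLyr T d"
  shows "is_functor (int_cat T) GrLyr d"
    and "i \<in> Obj (int_cat T) \<Longrightarrow> y \<in> verts (fst (fobj d i)) \<Longrightarrow> fun_of (farr d (IdArr i)) y = y"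
    and "k \<in> Arr (int_cat T) \<Longrightarrow> inj_on (fun_of (farr d k)) (verts (fst (fobj d (Dom (int_cat T) k))))"
proof -
  show F: "is_functor (int_cat T) GrLyr d"
    using assms by (simp add: structured_decomposition_def)
  then show "i \<in> Obj (int_cat T) \<Longrightarrow> y \<in> verts (fst (fobj d i)) \<Longrightarrow> fun_of (farr d (IdArr i)) y = y"
    using Lyr.fun_of_Ident by (simp add: is_functor_def Ident_int_cat)
  show "inj_on (fun_of (farr d k)) (verts (fst (fobj d (Dom (int_cat T) k))))" if k: "k \<in> Arr (int_cat T)"
    using assms k Lyr_mono_iff[OF Lyr.farr_hom[OF F k]] by (simp add: structured_decomposition_def)
qed

lemma Lyr_tree_elem_eq_same_node:
  assumes T: "T \<in> Trees" and d: "structured_decomposition GrLyr T d"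
    and "((i, a), (i, b)) \<in> elem_eq (int_cat T) (\<lambda>X. verts (fst X)) d"
    and "i \<in> Obj (int_cat T)" "a \<in> verts (fst (fobj d i))" "b \<in> verts (fst (fobj d i))"
  shows "a = b"
proof (rule tree_elem_eq_same_node[OF T _ _ assms(3-6)])
  show "fun_of (farr d (IdArr i)) y = y" if "i \<in> Obj (int_cat T)" "y \<in> verts (fst (fobj d i))" for i y
    by (rule Lyr_decomposition_functor(2)[OF d that])
  show "inj_on (fun_of (farr d (Incl e x))) (verts (fst (fobj d (Edge e))))" if "e \<in> edge_set T" "x \<in> e" for e x
    using Lyr_decomposition_functor(3)[OF d, of "Incl e x"] that by (simp add: Arr_int_cat)
qed

text \<open>The quotient of the disjoint union of the bags is a graph because each bag embeds into it, so
  that no edge is collapsed to a loop.\<close>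

lemma tree_layered_colimit_ex:
  assumes T: "T \<in> Trees" and d: "structured_decomposition GrLyr T d"
  obtains X c where "cocone (int_cat T) GrLyr d X c" "layered_colimit (int_cat T) d X c"
proof -
  let ?J = "int_cat T" and ?R = "elem_eq (int_cat T) (\<lambda>X. verts (fst X)) d"
  have G: "is_graph T"
    using T by (simp add: Trees_def)
  have J: "category ?J"
    by (rule int_cat_category[OF G])
  have F: "is_functor ?J GrLyr d"
    by (rule Lyr_decomposition_functor[OF d])
  have Ob: "fobj d i \<in> layered_graphs" if "i \<in> Obj ?J" for i
    using F that by (simp add: is_functor_def)
  define D where "D = (SIGMA i:Obj ?J. verts (fst (fobj d i)))"
  \<comment> \<open>Classes are formed in the set of all pairs; only those of pairs in
    \<open>D\<close> become vertices.\<close>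
  define \<pi> where "\<pi> i a = ?R `` {(i, a)}" for i a
  define V where "V = (\<lambda>(i, a). \<pi> i a) ` D"
  define E where "E = {(\<pi> i a, \<pi> i b) | i a b. i \<in> Obj ?J \<and> (a, b) \<in> adj (fst (fobj d i))}"
  \<comment> \<open>The layer is read off an arbitrary representative; the choice does not matter,
    because all arrows of the diagram preserve layers.\<close>
  define L where "L z = snd (fobj d (fst (SOME s. s \<in> z))) (snd (SOME s. s \<in> z))" for z
  have \<pi>_eq: "\<pi> i a = \<pi> j b \<longleftrightarrow> ((i, a), (j, b)) \<in> ?R" for i j a b
    unfolding \<pi>_def by (rule eq_equiv_class_iff[OF elem_eq_equiv UNIV_I UNIV_I])
  have layer_eq: "snd (fobj d j) b = snd (fobj d i) a"
    if "((i, a), (j, b)) \<in> ?R" for i j a b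
    using that
  proof (induction rule: elem_eq_induct)
    case (fwd k x)
    then show ?case
      using Lyr_hom_layer[OF Lyr.farr_hom[OF F fwd(1)] fwd(2)] by simp
  next
    case (bwd k x)
    then show ?case
      using Lyr_hom_layer[OF Lyr.farr_hom[OF F bwd(1)] bwd(2)] by simp
  qed simp
  have L: "L (\<pi> i a) = snd (fobj d i) a" for i a
  proof -
    have "(SOME s. s \<in> \<pi> i a) \<in> \<pi> i a"
      by (rule someI[of _ "(i, a)"]) (simp add: \<pi>_def elem_eq_refl)
    then have "((i, a), (fst (SOME s. s \<in> \<pi> i a), snd (SOME s. s \<in> \<pi> i a))) \<in> ?R"
      by (simp add: \<pi>_def)
    then show ?thesis
      unfolding L_def by (rule layer_eq)
  qed
  obtain X h where X: "X \<in> layered_graphs" and h: "bij_betw h V (verts (fst X))"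
    and adjX: "adj (fst X) = {(h x, h y) | x y. (x, y) \<in> E}" and LX: "\<And>x. x \<in> V \<Longrightarrow> snd X (h x) = L x"
  proof (rule layered_graph_skeleton[of V E L])
    have "finite D"
      unfolding D_def using finite_Obj_int_cat[OF G] layered_finite[OF Ob] by auto
    then show "finite V"
      by (simp add: V_def)
    show "E \<subseteq> V \<times> V"
      using layered_adj[OF Ob] by (fastforce simp: E_def V_def D_def)
    show "sym E"
      unfolding E_def sym_def using layered_adj(4)[OF Ob] by blast
    show "irrefl E"
    proof (rule irreflI)
      fix z
      show "(z, z) \<notin> E"
      proof
        assume "(z, z) \<in> E"
        then obtain i a b where i: "i \<in> Obj ?J" and ab: "(a, b) \<in> adj (fst (fobj d i))" and "\<pi> i a = \<pi> i b"
          by (auto simp: E_def)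
        then have "a = b"
          using Lyr_tree_elem_eq_same_node[OF T d _ i] \<pi>_eq layered_adj[OF Ob[OF i] ab] by blast
        then show False
          using layered_adj(3)[OF Ob[OF i] ab] by simp
      qed
    qed
    show "\<bar>int (L x) - int (L y)\<bar> \<le> 1" if "(x, y) \<in> E" for x y
      using that layered_adj(5)[OF Ob] unfolding E_def by (auto simp: L)
  qed (rule that)
  have \<pi>V: "\<pi> i a \<in> V" if "i \<in> Obj ?J" "a \<in> verts (fst (fobj d i))" for i a
    using that by (auto simp: V_def D_def)
  have hV: "h z \<in> verts (fst X)" if "z \<in> V" for z
    using h that by (rule bij_betwE[THEN bspec])
  define c where "c i = (fobj d i, restrict (\<lambda>a. h (\<pi> i a)) (verts (fst (fobj d i))), X)" for i
  have c: "c i \<in> hom GrLyr (fobj d i) X" if i: "i \<in> Obj ?J" for i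
    unfolding c_def
  proof (rule Lyr_homI[OF Ob[OF i] X])
    fix a assume a: "a \<in> verts (fst (fobj d i))"
    show "h (\<pi> i a) \<in> verts (fst X)"
      by (rule hV[OF \<pi>V[OF i a]])
    show "snd X (h (\<pi> i a)) = snd (fobj d i) a"
      by (simp add: LX[OF \<pi>V[OF i a]] L)
  next
    fix a b assume "(a, b) \<in> adj (fst (fobj d i))"
    then show "(h (\<pi> i a), h (\<pi> i b)) \<in> adj (fst X)"
      unfolding adjX E_def using i by blast
  qed
  have fc: "fun_of (c i) a = h (\<pi> i a)" if "a \<in> verts (fst (fobj d i))" for i a
    using that by (simp add: c_def fun_of_def)
  have "cocone ?J GrLyr d X c"
    unfolding cocone_def
  proof (intro conjI ballI c)
    fix k assume k: "k \<in> Arr ?J"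
    have D: "Dom ?J k \<in> Obj ?J" and C: "Cod ?J k \<in> Obj ?J"
      using category.dom_obj[OF J k] category.cod_obj[OF J k] by auto
    note dk = Lyr.farr_hom[OF F k]
    show "Comp GrLyr (c (Cod ?J k)) (farr d k) = c (Dom ?J k)"
    proof (rule Lyr.hom_eqI[OF Lyr.comp_in_hom[OF dk c[OF C]] c[OF D]])
      fix a assume a: "a \<in> verts (fst (fobj d (Dom ?J k)))"
      have "\<pi> (Dom ?J k) a = \<pi> (Cod ?J k) (fun_of (farr d k) a)"
        unfolding \<pi>_eq by (rule elem_eq_step[where U = "\<lambda>X. verts (fst X)", OF k a])
      then show "fun_of (Comp GrLyr (c (Cod ?J k)) (farr d k)) a = fun_of (c (Dom ?J k)) a"
        by (simp add: Lyr.fun_of_Comp[OF dk c[OF C] a] fc a Lyr.fun_of_in[OF dk a])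
    qed
  qed (use X in simp)
  moreover have "layered_colimit ?J d X c"
    unfolding layered_colimit_def set_colimit_def
  proof (intro conjI ballI allI impI)
    fix x assume "x \<in> verts (fst X)"
    then have "x \<in> h ` V"
      using h by (simp add: bij_betw_imp_surj_on)
    then obtain i a where i: "i \<in> Obj ?J" and a: "a \<in> verts (fst (fobj d i))" and "h (\<pi> i a) = x"
      by (auto simp: V_def D_def)
    then have "fun_of (c i) a = x"
      by (simp add: fc)
    then show "\<exists>i\<in>Obj ?J. \<exists>a\<in>verts (fst (fobj d i)). fun_of (c i) a = x"
      using i a by blast
  next
    fix i j a b
    assume i: "i \<in> Obj ?J" and j: "j \<in> Obj ?J" and a: "a \<in> verts (fst (fobj d i))"
      and b: "b \<in> verts (fst (fobj d j))" and eq: "fun_of (c i) a = fun_of (c j) b"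
    have "h (\<pi> i a) = h (\<pi> j b)"
      using eq by (simp add: fc a b)
    then have "\<pi> i a = \<pi> j b"
      by (rule inj_onD[OF bij_betw_imp_inj_on[OF h] _ \<pi>V[OF i a] \<pi>V[OF j b]])
    then show "((i, a), (j, b)) \<in> ?R"
      by (simp add: \<pi>_eq)
  next
    fix x y assume "(x, y) \<in> adj (fst X)"
    then obtain i a b where i: "i \<in> Obj ?J" and ab: "(a, b) \<in> adj (fst (fobj d i))"
      and xy: "x = h (\<pi> i a)" "y = h (\<pi> i b)"
      unfolding adjX E_def by blast
    have "fun_of (c i) a = x" "fun_of (c i) b = y"
      using fc layered_adj(1,2)[OF Ob[OF i] ab] xy by simp_all
    then show "\<exists>i\<in>Obj ?J. \<exists>a b. (a, b) \<in> adj (fst (fobj d i)) \<and> fun_of (c i) a = x \<and> fun_of (c i) b = y"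
      using i ab by blast
  qed
  ultimately show thesis
    by (rule that)
qed

text \<open>The explicit quotient has this description and every colimit cocone is isomorphic to it,
  so (W3) and the width computation can start from an arbitrary colimit.\<close>

lemma tree_colimit_layered_colimit:
  assumes T: "T \<in> Trees" and d: "structured_decomposition GrLyr T d"
    and col: "colimit_cocone (int_cat T) GrLyr d Y e"
  shows "layered_colimit (int_cat T) d Y e"
proof -
  obtain X c where X: "cocone (int_cat T) GrLyr d X c" "layered_colimit (int_cat T) d X c"
    using tree_layered_colimit_ex[OF T d] .
  have "category (int_cat T)"
    using T by (simp add: Trees_def int_cat_category)
  from layered_colimit_imp_colimit[OF Lyr_decomposition_functor(1)[OF d] this X]
  show ?thesis
    using layered_colimit_transfer[OF _ col] X(2) by blast
qed

section \<open>Spine and width\<close>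

context category
begin

lemma isomorphic_sym: "isomorphic C X Y \<Longrightarrow> isomorphic C Y X"
  unfolding isomorphic_def by blast

lemma isomorphic_refl: "X \<in> Obj C \<Longrightarrow> isomorphic C X X"
  unfolding isomorphic_def using ident_hom comp_ident_left by blast

lemma isomorphic_trans:
  assumes "isomorphic C X Y" "isomorphic C Y Z"
  shows "isomorphic C X Z"
proof -
  obtain f g where fg: "f \<in> hom C X Y" "g \<in> hom C Y X" "Comp C g f = Ident C X" "Comp C f g = Ident C Y"
    using assms(1) unfolding isomorphic_def by blast
  obtain h k where hk: "h \<in> hom C Y Z" "k \<in> hom C Z Y" "Comp C k h = Ident C Y" "Comp C h k = Ident C Z"
    using assms(2) unfolding isomorphic_def by blast
  have "Comp C (Comp C g k) (Comp C h f) = Comp C g (Comp C (Comp C k h) f)"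
    using comp_assoc[OF comp_hom[OF fg(1) hk(1)] hk(2) fg(2)] comp_assoc[OF fg(1) hk(1) hk(2)] by simp
  then have 1: "Comp C (Comp C g k) (Comp C h f) = Ident C X"
    using hk(3) fg(3) comp_ident_left[OF fg(1)] by simp
  have "Comp C (Comp C h f) (Comp C g k) = Comp C h (Comp C (Comp C f g) k)"
    using comp_assoc[OF comp_hom[OF hk(2) fg(2)] fg(1) hk(1)] comp_assoc[OF hk(2) fg(2) fg(1)] by simp
  then have 2: "Comp C (Comp C h f) (Comp C g k) = Ident C Z"
    using fg(4) hk(4) comp_ident_left[OF hk(2)] by simp
  show ?thesis
    unfolding isomorphic_def using 1 2 comp_hom[OF fg(1) hk(1)] comp_hom[OF hk(2) fg(2)] by blast
qed

lemma isomorphic_has_mono: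
  assumes "isomorphic C X Y"
  shows "has_mono C X Y"
proof -
  obtain f g where f: "f \<in> hom C X Y" and g: "g \<in> hom C Y X" and gf: "Comp C g f = Ident C X"
    using assms unfolding isomorphic_def by blast
  have D: "Dom C f = X" "f \<in> Arr C"
    using f by (auto simp: hom_def)
  have cancel: "Comp C g (Comp C f h) = h" if "h \<in> hom C Z X" for Z h
    using comp_assoc[OF that f g] gf comp_ident_left[OF that] by simp
  have "h = k" if "h \<in> hom C Z X" "k \<in> hom C Z X" "Comp C f h = Comp C f k" for Z h k
    by (subst cancel[OF that(1), symmetric], subst that(3), rule cancel[OF that(2)])
  then have "monomorphism C f"
    unfolding monomorphism_def D(1) using D(2) by blast
  then show ?thesis
    unfolding has_mono_def using f by blast
qed

end

section \<open>Layer sizes and embeddings into \<open>K i\<close>\<close>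

abbreviation lyr :: "lgraph \<Rightarrow> nat \<Rightarrow> nat set" where
  "lyr X \<equiv> layer (fst X) (snd X)"

lemma finite_lyr: "X \<in> layered_graphs \<Longrightarrow> finite (lyr X n)"
  using layered_finite by (simp add: layer_def)

lemma lyr_image:
  assumes "f \<in> hom GrLyr X Y"
  shows "fun_of f ` lyr X n = lyr Y n \<inter> fun_of f ` verts (fst X)"
  using Lyr_hom_layer[OF assms] Lyr.fun_of_in[OF assms] by (auto simp: layer_def)

text \<open>A monomorphism is injective and preserves layers, so it restricts to an injection of
  each layer. This is the obstruction to embedding into the spine.\<close>

lemma has_mono_card_lyr:
  assumes "has_mono GrLyr X Y"
  shows "card (lyr X n) \<le> card (lyr Y n)"
proof -
  obtain f where f: "f \<in> hom GrLyr X Y" and "monomorphism GrLyr f"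
    using assms unfolding has_mono_def by blast
  then have inj: "inj_on (fun_of f) (verts (fst X))"
    using Lyr_mono_iff by blast
  show ?thesis
  proof (rule card_inj_on_le)
    show "inj_on (fun_of f) (lyr X n)"
      by (rule inj_on_subset[OF inj]) (auto simp: layer_def)
    show "fun_of f ` lyr X n \<subseteq> lyr Y n"
      using lyr_image[OF f] by blast
    show "finite (lyr Y n)"
      using finite_lyr Lyr.hom_obj[OF f] by blast
  qed
qed

lemma isomorphic_card_lyr: "isomorphic GrLyr X Y \<Longrightarrow> card (lyr X n) = card (lyr Y n)"
  by (intro antisym has_mono_card_lyr category.isomorphic_has_mono[OF Lyr.is_category])
    (simp_all add: category.isomorphic_sym[OF Lyr.is_category])

lemma K_verts: "verts (fst (K i)) = {..<\<Sum>k\<in>{k. i k \<noteq> 0}. i k}"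
  and K_snd: "snd (K i) = K_layering i"
  and K_adj: "(x, y) \<in> adj (fst (K i)) \<longleftrightarrow> x \<in> verts (fst (K i)) \<and> y \<in> verts (fst (K i)) \<and> x \<noteq> y \<and>
    (snd (K i) x = snd (K i) y \<or> snd (K i) y = Suc (snd (K i) x) \<or> snd (K i) x = Suc (snd (K i) y))"
  by (auto simp: K_def Let_def)

lemma K_layered_graph: "K i \<in> layered_graphs"
proof -
  have "is_graph (fst (K i))"
    unfolding is_graph_def using K_verts K_adj by (auto simp: sym_def irrefl_def)
  moreover have "layering (fst (K i)) (snd (K i))"
    unfolding layering_def using K_adj[of _ _ i] by (auto simp: K_snd K_verts K_layering_def)
  ultimately show ?thesis
    by (simp add: layered_graphs_def)
qed

text \<open>The partial sums of \<open>i\<close> cut the vertex set into consecutive intervals. They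
  stall at empty layers, so an empty layer is never the first index whose partial sum exceeds
  \<open>v\<close>, in accordance with its empty interval.\<close>

lemma lyr_K:
  assumes i: "i \<in> seqI"
  shows "lyr (K i) n = {(\<Sum>k<n. i k)..<(\<Sum>k\<le>n. i k)}"
proof -
  let ?S = "{k. i k \<noteq> 0}"
  have fin: "finite ?S"
    using i by (simp add: seqI_def)
  have le: "(\<Sum>k\<le>m. i k) \<le> sum i ?S" for m
  proof -
    have "(\<Sum>k\<le>m. i k) = sum i ({..m} \<inter> ?S)"
      by (rule sum.mono_neutral_right) auto
    also have "\<dots> \<le> sum i ?S"
      by (rule sum_mono2[OF fin]) auto
    finally show ?thesis .
  qed
  \<comment> \<open>Finite support makes the partial sums reach the total, so the
    \<open>LEAST\<close> is attained.\<close>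
  have ex: "\<exists>m. v < (\<Sum>k\<le>m. i k)" if "v < sum i ?S" for v
  proof -
    obtain m where "?S \<subseteq> {..m}"
      using fin unfolding finite_nat_set_iff_bounded_le by blast
    then have "sum i ?S \<le> (\<Sum>k\<le>m. i k)"
      by (intro sum_mono2) auto
    then show ?thesis
      using that by (meson order_less_le_trans)
  qed
  have eq: "(LEAST m. v < (\<Sum>k\<le>m. i k)) = n \<longleftrightarrow> (\<Sum>k<n. i k) \<le> v \<and> v < (\<Sum>k\<le>n. i k)"
    if v: "v < sum i ?S" for v
  proof
    assume n: "(LEAST m. v < (\<Sum>k\<le>m. i k)) = n"
    have "(\<Sum>k<n. i k) \<le> v"
    \<comment> \<open>By minimality the preceding partial sum does not exceed \<open>v\<close>; for
      \<open>n = 0\<close> it is the empty sum.\<close>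
    proof (cases n)
      case (Suc m)
      then have "\<not> v < (\<Sum>k\<le>m. i k)"
        using n not_less_Least[of m "\<lambda>m. v < (\<Sum>k\<le>m. i k)"] by simp
      then show ?thesis
        by (simp add: Suc lessThan_Suc_atMost)
    qed simp
    moreover have "v < (\<Sum>k\<le>n. i k)"
      using LeastI_ex[OF ex[OF v]] n by simp
    ultimately show "(\<Sum>k<n. i k) \<le> v \<and> v < (\<Sum>k\<le>n. i k)" ..
  next
    assume n: "(\<Sum>k<n. i k) \<le> v \<and> v < (\<Sum>k\<le>n. i k)"
    show "(LEAST m. v < (\<Sum>k\<le>m. i k)) = n"
    proof (rule Least_equality)
      show "v < (\<Sum>k\<le>n. i k)"
        using n ..
      show "n \<le> m" if m: "v < (\<Sum>k\<le>m. i k)" for m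
      proof (rule ccontr)
        assume "\<not> n \<le> m"
        then have "(\<Sum>k\<le>m. i k) \<le> (\<Sum>k<n. i k)"
          by (intro sum_mono2) auto
        then show False
          using m n by linarith
      qed
    qed
  qed
  show ?thesis
  proof (intro set_eqI iffI)
    fix v assume "v \<in> lyr (K i) n"
    then show "v \<in> {(\<Sum>k<n. i k)..<(\<Sum>k\<le>n. i k)}"
      using eq[of v] by (auto simp: layer_def K_verts K_snd K_layering_def)
  next
    fix v assume v: "v \<in> {(\<Sum>k<n. i k)..<(\<Sum>k\<le>n. i k)}"
    then have "v < sum i ?S"
      using le[of n] by (meson atLeastLessThan_iff order_less_le_trans)
    then show "v \<in> lyr (K i) n"
      using eq[of v] v by (auto simp: layer_def K_verts K_snd K_layering_def)
  qed
qed

lemma card_lyr_K: "i \<in> seqI \<Longrightarrow> card (lyr (K i) n) = i n"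
  by (simp add: lyr_K lessThan_Suc_atMost[symmetric])

text \<open>In \<open>K i\<close> distinct vertices in equal or consecutive layers are adjacent, so
  every layer-preserving injection is a homomorphism. It is glued from injections of the single
  layers, which exist by cardinality.\<close>

lemma has_mono_K:
  assumes X: "X \<in> layered_graphs" and i: "i \<in> seqI" and le: "\<And>n. card (lyr X n) \<le> i n"
  shows "has_mono GrLyr X (K i)"
proof -
  have "\<exists>h. inj_on h (lyr X n) \<and> h ` lyr X n \<subseteq> lyr (K i) n" for n
    using inj_on_iff_card_le[OF finite_lyr[OF X] finite_lyr[OF K_layered_graph]] le
    by (simp add: card_lyr_K[OF i])
  then obtain h where h: "\<And>n. inj_on (h n) (lyr X n)" "\<And>n. h n ` lyr X n \<subseteq> lyr (K i) n"
    by metis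
  define f where "f x = h (snd X x) x" for x
  have f: "f x \<in> verts (fst (K i))" "snd (K i) (f x) = snd X x" if "x \<in> verts (fst X)" for x
  proof -
    have "x \<in> lyr X (snd X x)"
      using that by (simp add: layer_def)
    then have "f x \<in> lyr (K i) (snd X x)"
      using h(2) by (auto simp: f_def)
    then show "f x \<in> verts (fst (K i))" "snd (K i) (f x) = snd X x"
      by (auto simp: layer_def)
  qed
  have inj: "inj_on f (verts (fst X))"
  proof (rule inj_onI)
    fix x y assume x: "x \<in> verts (fst X)" and y: "y \<in> verts (fst X)" and eq: "f x = f y"
    then have "snd X x = snd X y"
      using f(2) by metis
    then show "x = y"
      using eq x y h(1)[of "snd X x"] by (auto simp: f_def layer_def dest: inj_onD)
  qed
  let ?f = "(X, restrict f (verts (fst X)), K i)"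
  have hom: "?f \<in> hom GrLyr X (K i)"
  proof (rule Lyr_homI[OF X K_layered_graph])
    fix x y assume xy: "(x, y) \<in> adj (fst X)"
    note v = layered_adj[OF X xy]
    \<comment> \<open>Preserving an edge requires distinct images, since \<open>K i\<close> has no
      loops.\<close>
    have "f x \<noteq> f y"
      using inj v(1-3) by (auto dest: inj_onD)
    moreover have "snd X x = snd X y \<or> snd X y = Suc (snd X x) \<or> snd X x = Suc (snd X y)"
      using v(5) by linarith
    ultimately show "(f x, f y) \<in> adj (fst (K i))"
      by (simp add: K_adj f v(1,2))
  qed (use f in auto)
  moreover have "inj_on (fun_of ?f) (verts (fst X))"
    using inj by (auto simp: fun_of_def inj_on_def)
  ultimately show ?thesis
    unfolding has_mono_def using Lyr_mono_iff by blast
qed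

text \<open>\<open>Max\<close> is meaningful here because a sequence with finite support has
  finitely many values.\<close>

lemma Max_range_seqI_le:
  assumes "i \<in> seqI"
  shows "Max (range i) \<le> n \<longleftrightarrow> (\<forall>k. i k \<le> n)"
proof -
  have "range i \<subseteq> insert 0 (i ` {k. i k \<noteq> 0})"
    by auto
  then have "finite (range i)"
    using assms by (auto simp: seqI_def intro: finite_subset)
  then show ?thesis
    by auto
qed

text \<open>This turns the size, defined through embeddings, into a count of vertices; (W2a) and
  (W2b) follow from it too.\<close>

lemma spineK_embeds_iff:
  assumes X: "X \<in> layered_graphs"
  shows "(\<exists>W\<in>spineK n. has_mono GrLyr X W) \<longleftrightarrow> (\<forall>m. card (lyr X m) \<le> n)"
proof
  assume "\<exists>W\<in>spineK n. has_mono GrLyr X W"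
  then obtain W i where W: "has_mono GrLyr X W" and i: "i \<in> seqI" "Max (range i) \<le> n" "isomorphic GrLyr W (K i)"
    unfolding spineK_def by blast
  show "\<forall>m. card (lyr X m) \<le> n"
  proof
    fix m
    have "card (lyr X m) \<le> card (lyr W m)"
      by (rule has_mono_card_lyr[OF W])
    also have "\<dots> = i m"
      using isomorphic_card_lyr[OF i(3)] card_lyr_K[OF i(1)] by simp
    also have "\<dots> \<le> n"
      using i Max_range_seqI_le by blast
    finally show "card (lyr X m) \<le> n" .
  qed
next
  assume le: "\<forall>m. card (lyr X m) \<le> n"
  \<comment> \<open>The witness is the sequence of layer sizes of \<open>X\<close> itself, the
    smallest one whose \<open>K i\<close> can receive \<open>X\<close>; its support is finite
    because \<open>X\<close> is.\<close>
  define i where "i m = card (lyr X m)" for m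
  have "{m. i m \<noteq> 0} \<subseteq> snd X ` verts (fst X)"
    by (auto simp: i_def layer_def card_eq_0_iff)
  then have i: "i \<in> seqI"
    using layered_finite[OF X] by (auto simp: seqI_def intro: finite_subset)
  have "Max (range i) \<le> n"
    unfolding Max_range_seqI_le[OF i] using le by (simp add: i_def)
  moreover have "isomorphic GrLyr (K i) (K i)"
    by (rule category.isomorphic_refl[OF Lyr.is_category]) (simp add: K_layered_graph)
  ultimately have "K i \<in> spineK n"
    unfolding spineK_def using K_layered_graph[of i] i by auto
  moreover have "has_mono GrLyr X (K i)"
    by (rule has_mono_K[OF X i]) (simp add: i_def)
  ultimately show "\<exists>W\<in>spineK n. has_mono GrLyr X W" ..
qed

lemma card_lyr_le: "X \<in> layered_graphs \<Longrightarrow> card (lyr X m) \<le> card (verts (fst X))"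
  by (rule card_mono) (auto simp: layer_def layered_finite)

section \<open>The axioms of a width category\<close>

lemma one_vertex_tree: "one_vertex_graph \<in> Trees"
proof -
  have "is_graph one_vertex_graph"
    by (auto simp: is_graph_def one_vertex_graph_def sym_def irrefl_def intro: exI[of _ 1])
  moreover have "\<not> is_cycle one_vertex_graph xs" for xs
    unfolding is_cycle_def one_vertex_graph_def by (cases xs) auto
  ultimately show ?thesis
    by (auto simp: Trees_def connected_graph_def one_vertex_graph_def)
qed

lemma Lyr_mono_obtain:
  assumes "monomorphism GrLyr f"
  shows "f \<in> hom GrLyr (Dom GrLyr f) (Cod GrLyr f)"
  using assms by (simp add: monomorphism_def hom_def)

lemma width_category_GrLyr: "width_category GrLyr Trees spineK"
proof -
  interpret category GrLyr
    by (rule Lyr.is_category)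
  have J: "category (int_cat T)" if "T \<in> Trees" for T
    using that by (simp add: Trees_def int_cat_category)
  have spine_layers: "\<exists>i\<in>seqI. (\<forall>m. card (lyr W m) = i m) \<and> isomorphic GrLyr W (K i)" if "W \<in> spineK n" for W n
    using that isomorphic_card_lyr card_lyr_K unfolding spineK_def by fastforce
  show ?thesis
  proof unfold_locales
    show "is_graph T" if "T \<in> Trees" for T
      using that by (simp add: Trees_def)
    show "one_vertex_graph \<in> Trees"
      by (rule one_vertex_tree)
    show "\<exists>X c. colimit_cocone (int_cat T) GrLyr d X c"
      if T: "T \<in> Trees" and d: "structured_decomposition GrLyr T d" for T d
    proof -
      obtain X c where "cocone (int_cat T) GrLyr d X c" "layered_colimit (int_cat T) d X c"
        using tree_layered_colimit_ex[OF T d] .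
      then show ?thesis
        using layered_colimit_imp_colimit[OF Lyr_decomposition_functor(1)[OF d] J[OF T]] by blast
    qed
    show "spineK n \<subseteq> Obj GrLyr" for n
      by (auto simp: spineK_def)
    show "Y \<in> spineK n" if "X \<in> spineK n" "Y \<in> Obj GrLyr" "isomorphic GrLyr X Y" for n X Y
      using that isomorphic_trans[OF isomorphic_sym] unfolding spineK_def by blast
    show "spineK n \<subseteq> spineK (Suc n)" for n
      unfolding spineK_def using le_SucI by blast
    \<comment> \<open>(W2a): the number of vertices is a crude bound for all layers at once.\<close>
    show "\<exists>W\<in>\<Union>n. spineK n. has_mono GrLyr X W" if "X \<in> Obj GrLyr" for X
      using spineK_embeds_iff[of X "card (verts (fst X))"] card_lyr_le[of X] that by auto
    \<comment> \<open>(W2b): if \<open>W\<close>, which is isomorphic to some \<open>K i\<close>,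
      embeds into an object of \<open>spineK n\<close>, then all \<open>i m\<close> are at most
      \<open>n\<close>, which puts \<open>W\<close> itself into \<open>spineK n\<close>.\<close>
    show "\<not> has_mono GrLyr W W'" if W: "W \<in> spineK (Suc n) - spineK n" and W': "W' \<in> spineK n" for n W W'
    proof
      assume "has_mono GrLyr W W'"
      moreover have WO: "W \<in> layered_graphs"
        using W by (simp add: spineK_def)
      ultimately have le: "\<forall>m. card (lyr W m) \<le> n"
        using spineK_embeds_iff[OF WO, of n] W' by blast
      obtain i where "i \<in> seqI" "\<forall>m. card (lyr W m) = i m" "isomorphic GrLyr W (K i)"
        using spine_layers W by blast
      then have "W \<in> spineK n"
        using le WO Max_range_seqI_le[of i n] unfolding spineK_def by auto
      then show False
        using W by simp
    qed
    show "\<exists>P p q. pullback GrLyr f g P p q"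
      if "monomorphism GrLyr f" "g \<in> Arr GrLyr" "Cod GrLyr f = Cod GrLyr g" for f g
      using Lyr_pullback_ex[OF Lyr_mono_obtain[OF that(1)], of g "Dom GrLyr g"] that by (simp add: hom_def)
    fix T d Y c f
    assume T: "T \<in> Trees" and d: "structured_decomposition GrLyr T d"
      and col: "colimit_cocone (int_cat T) GrLyr d Y c" and mono: "monomorphism GrLyr f" and Y: "Cod GrLyr f = Y"
    have f: "f \<in> hom GrLyr (Dom GrLyr f) Y"
      using Lyr_mono_obtain[OF mono] Y by simp
    have c: "cocone (int_cat T) GrLyr d Y c"
      using col by (simp add: colimit_cocone_def)
    note F = Lyr_decomposition_functor(1)[OF d]
    show "\<exists>d' p q. pullback_cocone (int_cat T) GrLyr d c f d' p q"
      by (rule pullback_cocone_ex[OF J[OF T] F c f]) (rule Lyr_pullback_ex[OF f Lyr.cocone_hom[OF c]])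
    fix d' p q
    assume pb: "pullback_cocone (int_cat T) GrLyr d c f d' p q"
    have "is_functor (int_cat T) GrLyr d'"
      using pb by (simp add: pullback_cocone_def)
    from layered_colimit_imp_colimit[OF this J[OF T]]
    show "colimit_cocone (int_cat T) GrLyr d' (Dom GrLyr f) p"
      using layered_colimit_pullback[OF J[OF T] F c tree_colimit_layered_colimit[OF T d col] f pb] by blast
  qed
qed

section \<open>Forgetting the layerings\<close>

lemma forget_arr_eq: "forget_arr a = (fst (fst a), fun_of a, fst (snd (snd a)))"
  by (simp add: forget_arr_def fun_of_def split: prod.splits)

lemma fun_of_forget_arr [simp]: "fun_of (forget_arr a) = fun_of a"
  by (simp add: forget_arr_eq fun_of_def)

lemma forget_arr_hom:
  assumes "a \<in> hom GrLyr A B"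
  shows "forget_arr a \<in> hom Gr (fst A) (fst B)"
proof -
  have a: "a = (A, fun_of a, B)"
    using assms by (simp add: Lyr.hom_iff)
  have "fst (fst a) = fst A" "fst (snd (snd a)) = fst B"
    by (subst a, simp)+
  then have "forget_arr a = (fst A, fun_of a, fst B)"
    by (simp add: forget_arr_eq)
  then show ?thesis
    using assms by (auto simp: Lyr.hom_iff layered_graphs_def layered_hom_def intro!: Gr.homI)
qed

lemma forget_arr_Comp:
  assumes a: "a \<in> hom GrLyr A B" and b: "b \<in> hom GrLyr B D"
  shows "forget_arr (Comp GrLyr b a) = Comp Gr (forget_arr b) (forget_arr a)"
  by (rule Gr.hom_eqI[OF forget_arr_hom[OF Lyr.comp_in_hom[OF a b]]
        Gr.comp_in_hom[OF forget_arr_hom[OF a] forget_arr_hom[OF b]]])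
    (simp add: Gr.fun_of_Comp[OF forget_arr_hom[OF a] forget_arr_hom[OF b]] Lyr.fun_of_Comp[OF a b])

lemma forget_arr_Ident:
  assumes A: "A \<in> layered_graphs"
  shows "forget_arr (Ident GrLyr A) = Ident Gr (fst A)"
proof (rule Gr.hom_eqI[OF forget_arr_hom[OF Lyr.ident_in_hom[OF A]]])
  show "Ident Gr (fst A) \<in> hom Gr (fst A) (fst A)"
    using A by (intro Gr.ident_in_hom) (simp add: layered_graphs_def)
qed (simp add: Gr.fun_of_Ident Lyr.fun_of_Ident)

lemma forget_diagram_sel [simp]:
  "fobj (forget_diagram d) i = fst (fobj d i)" "farr (forget_diagram d) k = forget_arr (farr d k)"
  by (simp_all add: forget_diagram_def)

lemma forget_functor:
  assumes J: "category J" and F: "is_functor J GrLyr d"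
  shows "is_functor J Gr (forget_diagram d)"
  unfolding is_functor_def
proof (intro conjI ballI impI)
  show "fobj (forget_diagram d) i \<in> Obj Gr" if "i \<in> Obj J" for i
    using F that by (auto simp: is_functor_def layered_graphs_def)
  show "farr (forget_diagram d) k \<in> hom Gr (fobj (forget_diagram d) (Dom J k)) (fobj (forget_diagram d) (Cod J k))"
    if "k \<in> Arr J" for k
    using forget_arr_hom[OF Lyr.farr_hom[OF F that]] by simp
  show "farr (forget_diagram d) (Ident J i) = Ident Gr (fobj (forget_diagram d) i)" if "i \<in> Obj J" for i
    using F that forget_arr_Ident by (auto simp: is_functor_def)
  show "farr (forget_diagram d) (Comp J b a) = Comp Gr (farr (forget_diagram d) b) (farr (forget_diagram d) a)"
    if a: "a \<in> Arr J" and b: "b \<in> Arr J" and ab: "Cod J a = Dom J b" for a b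
    using F a b ab forget_arr_Comp[OF Lyr.farr_hom[OF F a, unfolded ab] Lyr.farr_hom[OF F b]]
    by (simp add: is_functor_def)
qed

text \<open>In \<open>Gr\<close> there are more cocones to test against, since their apex need not
  be layered. The description of the colimit settles them as well: \<open>elem_eq\<close> depends
  only on the underlying functions, and the lifting of edges does not involve layers.\<close>

lemma forget_colimit:
  assumes J: "category J" and F: "is_functor J GrLyr d" and c: "cocone J GrLyr d X c"
    and col: "layered_colimit J d X c"
  shows "colimit_cocone J Gr (forget_diagram d) (fst X) (forget_arr \<circ> c)"
proof (rule Gr.set_colimit_imp_colimit[OF forget_functor[OF J F] J])
  have X: "X \<in> layered_graphs"
    using c by (simp add: cocone_def)
  show "cocone J Gr (forget_diagram d) (fst X) (forget_arr \<circ> c)"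
    unfolding cocone_def
  proof (intro conjI ballI)
    show "fst X \<in> Obj Gr"
      using X by (simp add: layered_graphs_def)
    show "(forget_arr \<circ> c) i \<in> hom Gr (fobj (forget_diagram d) i) (fst X)" if "i \<in> Obj J" for i
      using forget_arr_hom[OF Lyr.cocone_hom[OF c that]] by simp
    show "Comp Gr ((forget_arr \<circ> c) (Cod J k)) (farr (forget_diagram d) k) = (forget_arr \<circ> c) (Dom J k)"
      if k: "k \<in> Arr J" for k
      using forget_arr_Comp[OF Lyr.farr_hom[OF F k] Lyr.cocone_hom[OF c category.cod_obj[OF J k]]] c k
      by (simp add: cocone_def)
  qed
  have "elem_eq J verts (forget_diagram d) = elem_eq J (\<lambda>X. verts (fst X)) d"
    by (simp add: elem_eq_def elem_step_def)
  then show "set_colimit J verts (forget_diagram d) (fst X) (forget_arr \<circ> c)"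
    using col by (simp add: layered_colimit_def set_colimit_def)
  fix Y u
  assume hom: "\<And>i. i \<in> Obj J \<Longrightarrow> edge_preserving (fobj (forget_diagram d) i) Y
    (compose (verts (fobj (forget_diagram d) i)) u (fun_of ((forget_arr \<circ> c) i)))"
  show "edge_preserving (fst X) Y u"
    unfolding edge_preserving_def
  proof
    fix e assume "e \<in> adj (fst X)"
    then obtain x y where e: "e = (x, y)" and "(x, y) \<in> adj (fst X)"
      by (cases e) auto
    then obtain i a b where i: "i \<in> Obj J" and ab: "(a, b) \<in> adj (fst (fobj d i))"
      "fun_of (c i) a = x" "fun_of (c i) b = y"
      using layered_colimit_adj[OF col] by blast
    have "fobj d i \<in> layered_graphs"
      using Lyr.hom_obj[OF Lyr.cocone_hom[OF c i]] by simp
    then have "(u x, u y) \<in> adj Y"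
      using hom[OF i] ab layered_adj[of "fobj d i" a b]
      by (force simp: edge_preserving_def compose_def)
    then show "case e of (x, y) \<Rightarrow> (u x, u y) \<in> adj Y"
      by (simp add: e)
  qed
qed

lemma spine_size_eq:
  assumes X: "X \<in> layered_graphs"
  shows "spine_size GrLyr spineK X = Max (range (\<lambda>m. card (lyr X m)))"
    and "finite (range (\<lambda>m. card (lyr X m)))"
proof -
  \<comment> \<open>The maximum runs over infinitely many layers, but their sizes are bounded by the
    number of vertices.\<close>
  show fin: "finite (range (\<lambda>m. card (lyr X m)))"
    by (rule finite_subset[of _ "{..card (verts (fst X))}"]) (use card_lyr_le[OF X] in auto)
  have "spine_size GrLyr spineK X = (LEAST n. Max (range (\<lambda>m. card (lyr X m))) \<le> n)"
    unfolding spine_size_def using fin by (simp add: spineK_embeds_iff[OF X])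
  also have "\<dots> = Max (range (\<lambda>m. card (lyr X m)))"
    by (rule Least_equality) simp_all
  finally show "spine_size GrLyr spineK X = Max (range (\<lambda>m. card (lyr X m)))" .
qed

text \<open>The colimit map of a bag preserves layers and is injective, as distinct elements of one
  node are never identified. So layer \<open>m\<close> of \<open>X\<close> meets the embedded bag in
  exactly the image of layer \<open>m\<close> of the bag, and both widths are maxima of the same
  numbers, up to the subtraction of 1.\<close>

lemma decomposition_width_GrLyr:
  assumes T: "T \<in> Trees" and d: "structured_decomposition GrLyr T d"
    and col: "colimit_cocone (int_cat T) GrLyr d X c"
  shows "decomposition_width GrLyr spineK T d =
    int (layered_width (fst X) (snd X) T (forget_diagram d) (forget_arr \<circ> c)) - 1"
proof -
  have c: "cocone (int_cat T) GrLyr d X c"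
    using col by (simp add: colimit_cocone_def)
  have G: "is_graph T" and ne: "verts T \<noteq> {}"
    using T by (auto simp: Trees_def connected_graph_def)
  define f where "f x m = card (lyr (fobj d (Vert x)) m)" for x m
  have V: "Vert x \<in> Obj (int_cat T)" if "x \<in> verts T" for x
    using that by (simp add: Obj_int_cat)
  have ob: "fobj d (Vert x) \<in> layered_graphs" if "x \<in> verts T" for x
    using Lyr.hom_obj[OF Lyr.cocone_hom[OF c V[OF that]]] by simp
  have cardf: "card (lyr X m \<inter> bag (forget_diagram d) (forget_arr \<circ> c) x) = f x m" if x: "x \<in> verts T" for x m
  proof -
    have "inj_on (fun_of (c (Vert x))) (verts (fst (fobj d (Vert x))))"
    proof (rule inj_onI)
      fix a b assume ab: "a \<in> verts (fst (fobj d (Vert x)))" "b \<in> verts (fst (fobj d (Vert x)))"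
        and eq: "fun_of (c (Vert x)) a = fun_of (c (Vert x)) b"
      show "a = b"
        by (rule Lyr_tree_elem_eq_same_node[OF T d _ V[OF x] ab])
          (rule layered_colimit_glue[OF tree_colimit_layered_colimit[OF T d col] V[OF x] V[OF x] ab eq])
    qed
    then have "inj_on (fun_of (c (Vert x))) (lyr (fobj d (Vert x)) m)"
      by (rule inj_on_subset) (auto simp: layer_def)
    moreover have "bag (forget_diagram d) (forget_arr \<circ> c) x = fun_of (c (Vert x)) ` verts (fst (fobj d (Vert x)))"
      by (simp add: bag_def forget_arr_eq)
    ultimately show ?thesis
      using lyr_image[OF Lyr.cocone_hom[OF c V[OF x]], of m] by (simp add: f_def card_image[symmetric])
  qed
  have sz: "spine_size GrLyr spineK (fobj d (Vert x)) = Max (range (f x))" and fin: "finite (range (f x))"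
    if "x \<in> verts T" for x
    using spine_size_eq[OF ob[OF that]] by (simp_all add: f_def)
  have "{card (lyr X i \<inter> bag (forget_diagram d) (forget_arr \<circ> c) x) | i x. x \<in> verts T} = {f x i | i x. x \<in> verts T}"
    by (intro Collect_cong ex_cong1) (metis cardf)
  also have "\<dots> = (\<Union>x\<in>verts T. range (f x))"
    by blast
  finally have S: "{card (lyr X i \<inter> bag (forget_diagram d) (forget_arr \<circ> c) x) | i x. x \<in> verts T} =
    (\<Union>x\<in>verts T. range (f x))" .
  have finV: "finite (verts T)"
    by (rule finite_verts[OF G])
  \<comment> \<open>A maximum over pairs of a vertex of \<open>T\<close> and a layer is a maximum
    over vertices of maxima over layers, \<open>T\<close> being nonempty.\<close>
  let ?M = "Max ((\<lambda>x. Max (range (f x))) ` verts T)"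
  have "Max (\<Union>x\<in>verts T. range (f x)) = ?M"
  proof (rule Max_eqI)
    show "finite (\<Union>x\<in>verts T. range (f x))"
      using finV fin by blast
    fix n assume "n \<in> (\<Union>x\<in>verts T. range (f x))"
    then obtain x where x: "x \<in> verts T" and n: "n \<in> range (f x)"
      by blast
    have "n \<le> Max (range (f x))"
      by (rule Max_ge[OF fin[OF x] n])
    also have "\<dots> \<le> ?M"
      by (rule Max_ge) (use finV x in auto)
    finally show "n \<le> ?M" .
  next
    have "?M \<in> (\<lambda>x. Max (range (f x))) ` verts T"
      by (rule Max_in) (use finV ne in auto)
    then obtain x where x: "x \<in> verts T" and M: "?M = Max (range (f x))"
      by blast
    have "Max (range (f x)) \<in> range (f x)"
      by (rule Max_in[OF fin[OF x]]) simp
    then show "?M \<in> (\<Union>x\<in>verts T. range (f x))"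
      using x M by auto
  qed
  moreover have "(\<lambda>x. spine_size GrLyr spineK (fobj d (Vert x))) ` verts T = (\<lambda>x. Max (range (f x))) ` verts T"
    by (rule image_cong) (simp_all add: sz)
  ultimately show ?thesis
    unfolding decomposition_width_def layered_width_def S by simp
qed

text \<open>Monomorphisms of layered graphs are injective, hence their underlying maps are monic in
  \<open>Gr\<close>.\<close>

lemma forget_tree_decomposition:
  assumes T: "T \<in> Trees" and d: "structured_decomposition GrLyr T d"
    and col: "colimit_cocone (int_cat T) GrLyr d X c"
  shows "layered_tree_decomposition (fst X) (snd X) T (forget_diagram d) (forget_arr \<circ> c)"
proof -
  have J: "category (int_cat T)"
    using T by (simp add: Trees_def int_cat_category)
  have c: "cocone (int_cat T) GrLyr d X c"
    using col by (simp add: colimit_cocone_def)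
  then have X: "X \<in> layered_graphs"
    by (simp add: cocone_def)
  note F = Lyr_decomposition_functor[OF d]
  have "structured_decomposition Gr T (forget_diagram d)"
    unfolding structured_decomposition_def
  proof (intro conjI ballI forget_functor[OF J F(1)])
    fix k assume k: "k \<in> Arr (int_cat T)"
    show "monomorphism Gr (farr (forget_diagram d) k)"
      unfolding forget_diagram_sel
      by (rule Gr.monoI[OF forget_arr_hom[OF Lyr.farr_hom[OF F(1) k]]]) (simp add: F(3)[OF k])
  qed
  moreover have "colimit_cocone (int_cat T) Gr (forget_diagram d) (fst X) (forget_arr \<circ> c)"
    by (rule forget_colimit[OF J F(1) c tree_colimit_layered_colimit[OF T d col]])
  ultimately show ?thesis
    using X T by (simp add: layered_tree_decomposition_def layered_graphs_def)
qed

theorem proposition3p7p4: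
  shows "width_category GrLyr Trees spineK \<and>
    (\<forall>T d G L c. T \<in> Trees \<longrightarrow> structured_decomposition GrLyr T d \<longrightarrow>
       colimit_cocone (int_cat T) GrLyr d (G, L) c \<longrightarrow>
       layered_tree_decomposition G L T (forget_diagram d) (forget_arr \<circ> c) \<and>
       decomposition_width GrLyr spineK T d =
         int (layered_width G L T (forget_diagram d) (forget_arr \<circ> c)) - 1)"
  using width_category_GrLyr forget_tree_decomposition[where X = "(_, _)"]
    decomposition_width_GrLyr[where X = "(_, _)"] by simp

end
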